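(* Let $k\in\mathbb{N}$, $z>0$, $\beta\ge0$, and let $\Phi:\mathbb{R}^d\to\mathbb{R}\cup\{\infty\}$ be measurable. If $\Phi(x):=\Phi(\|x\|)$ is a decreasing and non-negative function on $\mathbb{R}_+$, then the stationary Gibbs point process in $\mathbb{R}^d$ with Papangelou intensity $\lambda^*(x,\gamma)=z\exp\{-\beta h(x,\gamma)\}$, where $$h(x,\gamma)=\sum_{y\in V^k(x,\gamma)}\Phi(x-y)+\sum_{y\in\gamma}\mathbf{1}_{V^k(y,\gamma\cup\{x\})}(x)\left[\Phi(y-x)-\Phi(y-v^k(y,\gamma))\right],$$ is not hyperuniform.
   Context: Points are unmarked. $\mathbf{N}$ is the set of locally finite subsets of $\mathbb{R}^d$ with its usual $\sigma$-field; $N_\Lambda(\gamma)$ is the number of points of $\gamma$ in $\Lambda$, $N(\gamma)$ is the cardinality of $\gamma$, and $|\cdot|$ is Lebesgue measure. For $\gamma\in\mathbf{N}$, $v^i(x,\gamma)$ is the $i$-th nearest neighbour of $x$ in $\gamma$, $i=1,\dots,k$, and $V^k(x,\gamma)=\{v^i(x,\gamma):i=1,\dots,\min\{k,N(\gamma)-1\}\}$ is the set of the first $k$ neighbours of $x$ in $\gamma$; ties in distance are broken by the lexicographic order. The function $h$ is the local energy associated with the energy $H(\gamma)=\sum_{x\in\gamma}\sum_{y\in V^k(x,\gamma)}\Phi(x-y)$ of finite configurations $\gamma$. A point process $\Gamma$ is a probability measure on $\mathbf{N}$ (also a random configuration with that law); it is stationary if its law is invariant under all translations of $\mathbb{R}^d$.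 $\Gamma$ is a Gibbs point process with Papangelou intensity $\lambda^*$ if for all positive measurable $f$, $$\int_{\mathbf{N}}\sum_{x\in\gamma}f(x,\gamma\setminus\{x\})\,\Gamma(d\gamma)=\int_{\mathbf{N}}\int_{\mathbb{R}^d}f(x,\gamma)\lambda^*(x,\gamma)\,dx\,\Gamma(d\gamma).$$ The claim is understood for every stationary Gibbs point process with this Papangelou intensity; existence of such a process is assumed. A stationary point process $\Gamma$ is hyperuniform if $\lim_{\Lambda\nearrow\mathbb{R}^d}\mathrm{Var}(N_\Lambda(\Gamma))/|\Lambda|=0$, where $\Lambda\nearrow\mathbb{R}^d$ means any sequence of increasing sets $\Lambda_1\subseteq\Lambda_2\subseteq\dots$ tending to the whole space $\mathbb{R}^d$. *)

theory Defs
  imports "HOL-Probability.Probability"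
begin

text \<open>The space $\mathbf{R}^d$ is \<open>real ^ 'n\<close> with \<open>d = CARD('n)\<close>; a linear order on the
  index type is needed to speak of the lexicographic order on points.\<close>

section \<open>Configurations and point processes\<close>

definition configs :: "('a::metric_space) set set" where
  "configs = {\<gamma>. \<forall>B. bounded B \<longrightarrow> finite (\<gamma> \<inter> B)}"

definition config_space :: "('a::metric_space) set measure" where
  "config_space = sigma configs
     {{\<gamma> \<in> configs. card (\<gamma> \<inter> B) = n} | B n. B \<in> sets borel \<and> bounded B}"

definition point_process :: "('a::metric_space) set measure \<Rightarrow> bool" where
  "point_process P \<longleftrightarrow> prob_space P \<and> sets P = sets config_space"

definition stationary :: "('a::real_normed_vector) set measure \<Rightarrow> bool" where
  "stationary P \<longleftrightarrow> point_process P \<and>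
     (\<forall>u. distr P config_space (\<lambda>\<gamma>. (\<lambda>x. u + x) ` \<gamma>) = P)"

text \<open>The sum over the points of a configuration is an integral with respect to counting measure.\<close>

definition gibbs :: "('a::euclidean_space \<Rightarrow> 'a set \<Rightarrow> ennreal) \<Rightarrow> 'a set measure \<Rightarrow> bool" where
  "gibbs papangelou P \<longleftrightarrow> point_process P \<and>
     (\<forall>f \<in> borel_measurable (borel \<Otimes>\<^sub>M config_space).
        (\<integral>\<^sup>+\<gamma>. (\<integral>\<^sup>+x. f (x, \<gamma> - {x}) \<partial>count_space \<gamma>) \<partial>P) =
        (\<integral>\<^sup>+\<gamma>. (\<integral>\<^sup>+x. f (x, \<gamma>) * papangelou x \<gamma> \<partial>lborel) \<partial>P))"

section \<open>Nearest neighbours\<close>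

definition lex_less :: "real ^ 'n::{finite,linorder} \<Rightarrow> real ^ 'n::{finite,linorder} \<Rightarrow> bool" where
  "lex_less u v \<longleftrightarrow> (\<exists>i. u $ i < v $ i \<and> (\<forall>j<i. u $ j = v $ j))"

definition nearer :: "real ^ 'n::{finite,linorder} \<Rightarrow> real ^ 'n::{finite,linorder} \<Rightarrow> real ^ 'n::{finite,linorder} \<Rightarrow> bool" where
  "nearer x u v \<longleftrightarrow> dist x u < dist x v \<or> (dist x u = dist x v \<and> lex_less u v)"

text \<open>A point is not its own neighbour, so the neighbours of \<open>x\<close> in \<open>\<gamma>\<close> are the points of
  \<open>\<gamma> - {x}\<close>. For \<open>x \<in> \<gamma>\<close> there are \<open>N(\<gamma>) - 1\<close> of them. For \<open>x \<notin> \<gamma>\<close> the set \<open>neighbours k x \<gamma>\<close> is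
  the one of \<open>x\<close> in \<open>\<gamma> \<union> {x}\<close>, which is what the energy of adding \<open>x\<close> to \<open>\<gamma>\<close> refers to.\<close>

definition has_neighbour :: "nat \<Rightarrow> real ^ 'n::{finite,linorder} \<Rightarrow> (real ^ 'n::{finite,linorder}) set \<Rightarrow> bool" where
  "has_neighbour i x \<gamma> \<longleftrightarrow> 1 \<le> i \<and> (infinite \<gamma> \<or> i \<le> card (\<gamma> - {x}))"

definition neighbour :: "nat \<Rightarrow> real ^ 'n::{finite,linorder} \<Rightarrow> (real ^ 'n::{finite,linorder}) set \<Rightarrow> real ^ 'n::{finite,linorder}" where
  "neighbour i x \<gamma> =
     (THE y. y \<in> \<gamma> - {x} \<and> Suc (card {u \<in> \<gamma> - {x}. nearer x u y}) = i)"

definition neighbours :: "nat \<Rightarrow> real ^ 'n::{finite,linorder} \<Rightarrow> (real ^ 'n::{finite,linorder}) set \<Rightarrow> (real ^ 'n::{finite,linorder}) set" where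
  "neighbours k x \<gamma> = {neighbour i x \<gamma> | i. i \<le> k \<and> has_neighbour i x \<gamma>}"

section \<open>Local energy and Papangelou intensity\<close>

text \<open>The second sum runs over a finite set for every \<open>\<gamma> \<in> configs\<close>: in a cone with apex \<open>x\<close> and
  angle below 60 degrees, at most \<open>k\<close> points of \<open>\<gamma>\<close> can have \<open>x\<close> among their first \<open>k\<close> neighbours.
  If \<open>y\<close> has fewer than \<open>k\<close> neighbours in \<open>\<gamma>\<close>, adding \<open>x\<close> displaces none of them and nothing is
  subtracted. In \<^typ>\<open>ereal\<close> we have \<open>\<infinity> - \<infinity> = \<infinity>\<close>; under a Gibbs process with non-negative,
  radially decreasing \<open>\<Phi>\<close> and \<open>\<beta> > 0\<close>, a pair \<open>y\<close>, \<open>neighbour k y \<gamma>\<close> at infinite energy almost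
  surely does not occur.\<close>

definition local_energy ::
  "(real ^ 'n::{finite,linorder} \<Rightarrow> ereal) \<Rightarrow> nat \<Rightarrow> real ^ 'n::{finite,linorder} \<Rightarrow> (real ^ 'n::{finite,linorder}) set \<Rightarrow> ereal" where
  "local_energy \<Phi> k x \<gamma> =
     (\<Sum>y \<in> neighbours k x \<gamma>. \<Phi> (x - y)) +
     (\<Sum>y \<in> {y \<in> \<gamma>. x \<in> neighbours k y (\<gamma> \<union> {x})}.
        \<Phi> (y - x) - (if has_neighbour k y \<gamma> then \<Phi> (y - neighbour k y \<gamma>) else 0))"

definition exp_ereal :: "ereal \<Rightarrow> ennreal" where
  "exp_ereal t = (case t of ereal r \<Rightarrow> ennreal (exp r) | PInfty \<Rightarrow> \<infinity> | MInfty \<Rightarrow> 0)"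

text \<open>For \<open>\<beta> = 0\<close> the intensity is the constant \<open>z\<close>, since \<open>0 * \<infinity> = 0\<close> in \<^typ>\<open>ereal\<close>.\<close>

definition knn_papangelou ::
  "real \<Rightarrow> real \<Rightarrow> (real ^ 'n::{finite,linorder} \<Rightarrow> ereal) \<Rightarrow> nat \<Rightarrow>
   real ^ 'n::{finite,linorder} \<Rightarrow> (real ^ 'n::{finite,linorder}) set \<Rightarrow> ennreal" where
  "knn_papangelou z \<beta> \<Phi> k x \<gamma> = ennreal z * exp_ereal (- (ereal \<beta> * local_energy \<Phi> k x \<gamma>))"

section \<open>Hyperuniformity\<close>

definition exhausting :: "(nat \<Rightarrow> ('a::metric_space) set) \<Rightarrow> bool" where
  "exhausting \<Lambda> \<longleftrightarrow>
     (\<forall>n. \<Lambda> n \<in> sets borel \<and> bounded (\<Lambda> n)) \<and> incseq \<Lambda> \<and> (\<Union>n. \<Lambda> n) = UNIV"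

text \<open>The sequence of windows is a parameter. Requiring the limit for all sequences of bounded Borel
  windows at once would leave only degenerate examples, since windows made of many tiny, widely
  scattered pieces produce a variance of the order of the volume for any point process of positive
  intensity. Square integrability is required because \<^const>\<open>prob_space.variance\<close> is a Bochner integral,
  which takes the value 0 instead of \<open>\<infinity>\<close> when the integrand is not integrable.\<close>

definition hyperuniform_along ::
  "(nat \<Rightarrow> ('a::euclidean_space) set) \<Rightarrow> 'a set measure \<Rightarrow> bool" where
  "hyperuniform_along \<Lambda> P \<longleftrightarrow>
     (\<forall>n. integrable P (\<lambda>\<gamma>. (real (card (\<gamma> \<inter> \<Lambda> n)))\<^sup>2)) \<and>
     (\<lambda>n. prob_space.variance P (\<lambda>\<gamma>. real (card (\<gamma> \<inter> \<Lambda> n))) / measure lborel (\<Lambda> n))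
       \<longlonglongrightarrow> 0"

end

theory Submission
  imports Defs
begin

text \<open>
  Let \<open>\<lambda>(x, \<gamma>)\<close> be the Papangelou intensity and \<open>N\<close> the number of points in a window \<open>\<Lambda>\<close> of volume
  \<open>|\<Lambda>|\<close>. The variance of \<open>N\<close> is shown to be at least a constant times \<open>|\<Lambda>|\<close>, by comparing \<open>N\<close> with
  another random variable. For a weight \<open>f(x, \<gamma>)\<close> that vanishes for \<open>x\<close> outside \<open>\<Lambda>\<close> let
  \<open>X = S - I\<close>, where \<open>S\<close> is the sum of \<open>f(x, \<gamma> - {x})\<close> over the points \<open>x\<close> of \<open>\<gamma>\<close> and \<open>I\<close> is the
  integral of \<open>f(x, \<gamma>) \<lambda>(x, \<gamma>)\<close> over \<open>x\<close>. The Gibbs equation says that \<open>X\<close> has mean 0; applied to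
  \<open>N f\<close>, where putting \<open>x\<close> back into the configuration raises \<open>N\<close> by one, it says that
  \<open>E[N X] = E[I]\<close>. So if \<open>E[I] \<ge> c |\<Lambda>|\<close> and \<open>E[X\<^sup>2] \<le> C |\<Lambda>|\<close>, then the Cauchy-Schwarz inequality
  gives \<open>Var N \<ge> c\<^sup>2 |\<Lambda>| / C\<close> (lemma \<open>variance_lower_bound\<close>).

  The bound on \<open>E[X\<^sup>2]\<close> rests on two properties. First, \<open>\<lambda> \<le> z\<close>: a new point displaces only
  neighbours that are at least as far away, so for a non-negative decreasing potential the local
  energy is non-negative (\<open>displacement_nonneg\<close>). Hence pairs of points at distance below \<open>D\<close> contribute at most
  in proportion to \<open>|\<Lambda>|\<close>. Second, locality: if \<open>f(x, \<gamma>)\<close> and \<open>f(x, \<gamma>) \<lambda>(x, \<gamma>)\<close> do not change when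
  points at distance at least \<open>D\<close> from \<open>x\<close> are added, then pairs at distance at least \<open>D\<close> contribute
  one and the same number to \<open>E[S\<^sup>2]\<close>, \<open>E[S I]\<close> and \<open>E[I\<^sup>2]\<close>, which cancels in \<open>E[X\<^sup>2]\<close>.

  The nearest-neighbour interaction has no bounded range, so locality is enforced by the choice of
  \<open>f\<close>: it is the indicator of the event that \<open>x\<close> lies in \<open>\<Lambda>\<close> and is shielded, meaning that balls
  placed at distance \<open>R\<close> around \<open>x\<close>, one in each direction of a finite net of the sphere, all contain
  more than \<open>k\<close> points. By the triangle inequality, \<open>\<lambda>(x, \<gamma>)\<close> then depends only on the points within
  distance \<open>4 R\<close> of \<open>x\<close> (\<open>local_energy_insert\<close>).

  For the bound on \<open>E[I]\<close> it remains to see that most points are shielded when \<open>R\<close> is large. A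
  stationary process almost surely has no finite nonempty configuration, and the empty one is
  excluded by the Gibbs equation because \<open>\<lambda>(x, {}) = z > 0\<close>. So there are infinitely many points, a
  large ball contains more than \<open>k\<close> of them with probability close to 1, and by stationarity this is
  uniform in the position of the ball. Since \<open>\<lambda> \<le> z\<close>, the unshielded points have small density
  compared with the positive density of all points (\<open>mean_compensator_lower_bound\<close>).
\<close>

section \<open>Measurability on the space of configurations\<close>

lemma space_config_space: "space config_space = configs"
  unfolding config_space_def by (rule space_measure_of) auto

lemma finite_config_Int: "\<gamma> \<in> configs \<Longrightarrow> bounded B \<Longrightarrow> finite (\<gamma> \<inter> B)"
  by (simp add: configs_def)

lemma configs_subset: "\<gamma> \<in> configs \<Longrightarrow> \<delta> \<subseteq> \<gamma> \<Longrightarrow> \<delta> \<in> configs"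
  unfolding configs_def by (auto intro: finite_subset[of "\<delta> \<inter> _" "\<gamma> \<inter> _"])

lemma configs_Diff: "\<gamma> \<in> configs \<Longrightarrow> \<gamma> - S \<in> configs"
  by (rule configs_subset) auto

lemma configs_insert: "\<gamma> \<in> configs \<Longrightarrow> insert x \<gamma> \<in> configs"
  unfolding configs_def by (auto simp: Int_insert_left)

lemma configs_countable:
  fixes \<gamma> :: "'a::metric_space set"
  assumes "\<gamma> \<in> configs" shows "countable \<gamma>"
proof -
  have "\<exists>n::nat. dist undefined x < real n" for x :: 'a
    using reals_Archimedean2 by blast
  then have "\<gamma> \<subseteq> (\<Union>n::nat. \<gamma> \<inter> ball undefined (real n))"
    by (simp add: subset_iff)
  moreover have "countable (\<Union>n::nat. \<gamma> \<inter> ball undefined (real n))"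
    using assms by (intro countable_UN) (auto intro!: countable_finite finite_config_Int)
  ultimately show ?thesis by (rule countable_subset)
qed

lemma measurable_card_Int:
  assumes "B \<in> sets borel" "bounded B"
  shows "(\<lambda>\<gamma>. card (\<gamma> \<inter> B)) \<in> measurable config_space (count_space UNIV)"
proof -
  have "(\<lambda>\<gamma>. card (\<gamma> \<inter> B)) -` {n} \<inter> space config_space \<in> sets config_space" for n
  proof -
    have "(\<lambda>\<gamma>. card (\<gamma> \<inter> B)) -` {n} \<inter> space config_space = {\<gamma> \<in> configs. card (\<gamma> \<inter> B) = n}"
      by (auto simp: space_config_space)
    also have "\<dots> \<in> sets config_space"
      unfolding config_space_def using assms by (auto simp: sets_measure_of intro!: sigma_sets.Basic)
    finally show ?thesis .
  qed
  then show ?thesis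
    by (subst measurable_count_space_eq2_countable) auto
qed

lemma measurable_config_spaceI:
  fixes g :: "'b \<Rightarrow> 'a::metric_space set"
  assumes "\<And>\<omega>. \<omega> \<in> space M \<Longrightarrow> g \<omega> \<in> configs"
    and "\<And>B. B \<in> sets borel \<Longrightarrow> bounded B \<Longrightarrow> (\<lambda>\<omega>. card (g \<omega> \<inter> B)) \<in> measurable M (count_space UNIV)"
  shows "g \<in> measurable M config_space"
  unfolding config_space_def
proof (rule measurable_measure_of)
  fix A :: "'a set set" assume "A \<in> {{\<gamma> \<in> configs. card (\<gamma> \<inter> B) = n} |B n. B \<in> sets borel \<and> bounded B}"
  then obtain B n where A: "A = {\<gamma> \<in> configs. card (\<gamma> \<inter> B) = n}" "B \<in> sets borel" "bounded B" by auto
  have "g -` A \<inter> space M = (\<lambda>\<omega>. card (g \<omega> \<inter> B)) -` {n} \<inter> space M"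
    using A assms(1) by auto
  then show "g -` A \<inter> space M \<in> sets M"
    using measurable_sets[OF assms(2)[OF A(2,3)], of "{n}"] by simp
qed (use assms(1) in auto)

text \<open>Counting measure on a configuration becomes a finite measure on each bounded window, and
  normalised it is a subprobability kernel; this reduces measurability of sums over the points of a
  configuration to measurability of integrals against subprobability kernels.\<close>

lemma measurable_sum_points:
  fixes g :: "'b \<Rightarrow> 'a::euclidean_space set"
  assumes g: "g \<in> measurable M config_space"
    and F: "case_prod F \<in> borel_measurable (M \<Otimes>\<^sub>M borel)"
  shows "(\<lambda>\<omega>. \<integral>\<^sup>+y. F \<omega> y \<partial>count_space (g \<omega>)) \<in> borel_measurable M"
proof -
  note [measurable] = F
  have gc: "g \<omega> \<in> configs" if "\<omega> \<in> space M" for \<omega>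
    using measurable_space[OF g that] by (simp add: space_config_space)
  have bounded: "(\<lambda>\<omega>. \<integral>\<^sup>+y. F \<omega> y * indicator B y \<partial>count_space (g \<omega>)) \<in> borel_measurable M"
    if B[measurable]: "B \<in> sets borel" and bB: "bounded B" for B
  proof -
    define K where "K \<omega> = scale_measure (inverse (of_nat (card (g \<omega> \<inter> B))))
      (distr (count_space (g \<omega> \<inter> B)) borel (\<lambda>y. y))" for \<omega>
    have sK: "sets (K \<omega>) = sets borel" "space (K \<omega>) = UNIV" for \<omega>
      by (simp_all add: K_def space_scale_measure)
    have fin: "finite (g \<omega> \<inter> B)" if "\<omega> \<in> space M" for \<omega>
      using finite_config_Int[OF gc[OF that] bB] .
    have eK: "emeasure (K \<omega>) C = inverse (of_nat (card (g \<omega> \<inter> B))) * of_nat (card (g \<omega> \<inter> (B \<inter> C)))"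
      if "\<omega> \<in> space M" "C \<in> sets borel" for \<omega> C
    proof -
      have "(\<lambda>y. y) -` C \<inter> (g \<omega> \<inter> B) = g \<omega> \<inter> (B \<inter> C)" by auto
      moreover have "emeasure (count_space (g \<omega> \<inter> B)) (g \<omega> \<inter> (B \<inter> C)) = of_nat (card (g \<omega> \<inter> (B \<inter> C)))"
        by (rule emeasure_count_space_finite) (use fin[OF that(1)] in \<open>auto intro: finite_subset[of _ "g \<omega> \<inter> B"]\<close>)
      ultimately show ?thesis using that
        unfolding K_def by (simp add: emeasure_distr)
    qed
    have cardm[measurable]: "(\<lambda>\<omega>. card (g \<omega> \<inter> C)) \<in> measurable M (count_space UNIV)"
      if "C \<in> sets borel" "bounded C" for C
      using measurable_compose[OF g measurable_card_Int[OF that]] by simp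
    have Km: "K \<in> measurable M (subprob_algebra borel)"
    proof (rule measurable_subprob_algebra)
      fix \<omega> assume \<omega>: "\<omega> \<in> space M"
      show "subprob_space (K \<omega>)"
      proof (rule subprob_spaceI)
        have "inverse (of_nat n :: ennreal) * of_nat n \<le> 1" for n
          by (cases "n = 0") (auto simp: ennreal_inverse_mult ennreal_of_nat_eq_real_of_nat inverse_ennreal ennreal_mult[symmetric])
        then show "emeasure (K \<omega>) (space (K \<omega>)) \<le> 1"
          using eK[OF \<omega>, of UNIV] by (simp add: sK)
        show "space (K \<omega>) \<noteq> {}" by (simp add: sK)
      qed
    next
      fix C :: "'a set" assume C: "C \<in> sets borel"
      have [measurable]: "(\<lambda>\<omega>. card (g \<omega> \<inter> (B \<inter> C))) \<in> measurable M (count_space UNIV)"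
        "(\<lambda>\<omega>. card (g \<omega> \<inter> B)) \<in> measurable M (count_space UNIV)"
        using C B bB by (auto intro!: cardm bounded_Int)
      have "(\<lambda>\<omega>. inverse (of_nat (card (g \<omega> \<inter> B))) * of_nat (card (g \<omega> \<inter> (B \<inter> C))) :: ennreal) \<in> borel_measurable M"
        by measurable
      then show "(\<lambda>\<omega>. emeasure (K \<omega>) C) \<in> borel_measurable M"
        using eK C by (subst measurable_cong) auto
    qed (simp add: sK)
    have "(\<integral>\<^sup>+y. F \<omega> y * indicator B y \<partial>count_space (g \<omega>)) =
          of_nat (card (g \<omega> \<inter> B)) * (\<integral>\<^sup>+y. F \<omega> y \<partial>K \<omega>)" if \<omega>: "\<omega> \<in> space M" for \<omega>
    proof -
      have Fm: "F \<omega> \<in> borel_measurable borel"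
        using measurable_Pair2[OF F \<omega>] by simp
      have "(\<integral>\<^sup>+y. F \<omega> y * indicator B y \<partial>count_space (g \<omega>)) = (\<integral>\<^sup>+y. F \<omega> y \<partial>count_space (g \<omega> \<inter> B))"
        by (subst (1 2) nn_integral_count_space_indicator)
          (auto intro!: nn_integral_cong split: split_indicator)
      also have "\<dots> = of_nat (card (g \<omega> \<inter> B)) * (inverse (of_nat (card (g \<omega> \<inter> B))) * (\<integral>\<^sup>+y. F \<omega> y \<partial>count_space (g \<omega> \<inter> B)))"
      proof (cases "g \<omega> \<inter> B = {}")
        case False
        then have "of_nat (card (g \<omega> \<inter> B)) * inverse (of_nat (card (g \<omega> \<inter> B))) = (1::ennreal)"
          using fin[OF \<omega>] by (simp add: ennreal_of_nat_eq_real_of_nat inverse_ennreal ennreal_mult[symmetric] card_gt_0_iff)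
        then show ?thesis by (simp add: mult.assoc[symmetric])
      qed (simp add: nn_integral_empty)
      also have "\<dots> = of_nat (card (g \<omega> \<inter> B)) * (\<integral>\<^sup>+y. F \<omega> y \<partial>K \<omega>)"
        unfolding K_def using Fm by (simp add: nn_integral_scale_measure nn_integral_distr)
      finally show ?thesis .
    qed
    moreover have "(\<lambda>\<omega>. of_nat (card (g \<omega> \<inter> B)) * (\<integral>\<^sup>+y. F \<omega> y \<partial>K \<omega>)) \<in> borel_measurable M"
    proof -
      have "(\<lambda>\<omega>. \<integral>\<^sup>+y. F \<omega> y \<partial>K \<omega>) \<in> borel_measurable M"
        by (rule nn_integral_measurable_subprob_algebra2[OF F Km])
      moreover have "(\<lambda>\<omega>. of_nat (card (g \<omega> \<inter> B)) :: ennreal) \<in> borel_measurable M"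
        using cardm[OF B bB] by measurable
      ultimately show ?thesis by measurable
    qed
    ultimately show ?thesis by (subst measurable_cong) auto
  qed
  have "(\<integral>\<^sup>+y. F \<omega> y \<partial>count_space (g \<omega>)) =
        (SUP n. \<integral>\<^sup>+y. F \<omega> y * indicator (ball 0 (real n)) y \<partial>count_space (g \<omega>))" for \<omega>
  proof -
    have "(\<integral>\<^sup>+y. F \<omega> y \<partial>count_space (g \<omega>)) =
        (\<integral>\<^sup>+y. (SUP n. F \<omega> y * indicator (ball 0 (real n)) y) \<partial>count_space (g \<omega>))"
    proof (intro nn_integral_cong antisym)
      fix y :: 'a
      obtain n where "norm y < real n" using reals_Archimedean2 by blast
      then show "F \<omega> y \<le> (SUP n. F \<omega> y * indicator (ball 0 (real n)) y)"
        by (intro SUP_upper2[of n]) auto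
      show "(SUP n. F \<omega> y * indicator (ball 0 (real n)) y) \<le> F \<omega> y"
        by (intro SUP_least) (auto split: split_indicator)
    qed
    also have "\<dots> = (SUP n. \<integral>\<^sup>+y. F \<omega> y * indicator (ball 0 (real n)) y \<partial>count_space (g \<omega>))"
      by (rule nn_integral_monotone_convergence_SUP)
        (auto intro!: incseq_SucI le_funI mult_left_mono split: split_indicator)
    finally show ?thesis .
  qed
  moreover have "(\<lambda>\<omega>. SUP n. \<integral>\<^sup>+y. F \<omega> y * indicator (ball 0 (real n)) y \<partial>count_space (g \<omega>)) \<in> borel_measurable M"
    by (intro borel_measurable_SUP bounded) auto
  ultimately show ?thesis by simp
qed

lemma emeasure_count_config:
  assumes "\<gamma> \<in> configs" "bounded B"
  shows "(\<integral>\<^sup>+y. indicator B y \<partial>count_space \<gamma>) = of_nat (card (\<gamma> \<inter> B))"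
proof -
  have "(\<integral>\<^sup>+y. indicator B y \<partial>count_space \<gamma>) = (\<integral>\<^sup>+y. indicator (\<gamma> \<inter> B) y \<partial>count_space \<gamma>)"
    by (intro nn_integral_cong) (auto split: split_indicator)
  also have "\<dots> = emeasure (count_space \<gamma>) (\<gamma> \<inter> B)"
    by (rule nn_integral_indicator) simp
  also have "\<dots> = of_nat (card (\<gamma> \<inter> B))"
    using finite_config_Int[OF assms] by (intro emeasure_count_space_finite) auto
  finally show ?thesis .
qed

lemma measurable_nat_of_ennreal:
  assumes "(\<lambda>\<omega>. of_nat (c \<omega>) :: ennreal) \<in> borel_measurable M"
  shows "c \<in> measurable M (count_space UNIV)"
proof (subst measurable_count_space_eq2_countable)
  have "c -` {n} \<inter> space M \<in> sets M" for n
  proof -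
    have "c -` {n} \<inter> space M = (\<lambda>\<omega>. of_nat (c \<omega>) :: ennreal) -` {of_nat n} \<inter> space M" by auto
    then show ?thesis using measurable_sets[OF assms, of "{of_nat n}"] by simp
  qed
  then show "c \<in> space M \<rightarrow> UNIV \<and> (\<forall>a\<in>UNIV. c -` {a} \<inter> space M \<in> sets M)" by auto
qed

lemma measurable_card_filter:
  fixes g :: "'b \<Rightarrow> 'a::euclidean_space set"
  assumes g: "g \<in> measurable M config_space"
    and Q [measurable]: "Measurable.pred (M \<Otimes>\<^sub>M borel) (\<lambda>(\<omega>, y). Q \<omega> y)"
    and fin: "\<And>\<omega>. \<omega> \<in> space M \<Longrightarrow> finite {y \<in> g \<omega>. Q \<omega> y}"
  shows "(\<lambda>\<omega>. card {y \<in> g \<omega>. Q \<omega> y}) \<in> measurable M (count_space UNIV)"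
proof (rule measurable_nat_of_ennreal)
  have "(\<lambda>\<omega>. \<integral>\<^sup>+y. (if Q \<omega> y then 1 else 0) \<partial>count_space (g \<omega>)) \<in> borel_measurable M"
    by (rule measurable_sum_points[OF g]) measurable
  also have "?this \<longleftrightarrow> (\<lambda>\<omega>. of_nat (card {y \<in> g \<omega>. Q \<omega> y}) :: ennreal) \<in> borel_measurable M"
  proof (rule measurable_cong)
    fix \<omega> assume \<omega>: "\<omega> \<in> space M"
    have "(\<integral>\<^sup>+y. (if Q \<omega> y then 1 else 0) \<partial>count_space (g \<omega>)) =
      (\<integral>\<^sup>+y. indicator {y \<in> g \<omega>. Q \<omega> y} y \<partial>count_space (g \<omega>))"
      by (intro nn_integral_cong) (auto split: split_indicator)
    also have "\<dots> = emeasure (count_space (g \<omega>)) {y \<in> g \<omega>. Q \<omega> y}"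
      by (rule nn_integral_indicator) auto
    also have "\<dots> = of_nat (card {y \<in> g \<omega>. Q \<omega> y})"
      by (rule emeasure_count_space_finite) (use fin[OF \<omega>] in auto)
    finally show "(\<integral>\<^sup>+y. (if Q \<omega> y then 1 else 0) \<partial>count_space (g \<omega>)) = of_nat (card {y \<in> g \<omega>. Q \<omega> y})" .
  qed
  finally show "(\<lambda>\<omega>. of_nat (card {y \<in> g \<omega>. Q \<omega> y}) :: ennreal) \<in> borel_measurable M" .
qed

lemma measurable_config_filter:
  fixes g :: "'b \<Rightarrow> 'a::euclidean_space set"
  assumes g: "g \<in> measurable M config_space"
    and Q: "Measurable.pred (M \<Otimes>\<^sub>M borel) (\<lambda>(\<omega>, y). Q \<omega> y)"
  shows "(\<lambda>\<omega>. {y \<in> g \<omega>. Q \<omega> y}) \<in> measurable M config_space"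
proof (rule measurable_config_spaceI)
  have gc: "g \<omega> \<in> configs" if "\<omega> \<in> space M" for \<omega>
    using measurable_space[OF g that] by (simp add: space_config_space)
  then show *: "{y \<in> g \<omega>. Q \<omega> y} \<in> configs" if "\<omega> \<in> space M" for \<omega>
    using configs_subset[OF gc[OF that]] by auto
  fix B :: "'a set" assume [measurable]: "B \<in> sets borel" and "bounded B"
  have "(\<lambda>\<omega>. card {y \<in> g \<omega>. Q \<omega> y \<and> y \<in> B}) \<in> measurable M (count_space UNIV)"
  proof (rule measurable_card_filter[OF g])
    show "finite {y \<in> g \<omega>. Q \<omega> y \<and> y \<in> B}" if "\<omega> \<in> space M" for \<omega>
      by (rule finite_subset[OF _ finite_config_Int[OF gc[OF that] \<open>bounded B\<close>]]) auto
  qed (use Q in measurable)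
  also have "(\<lambda>\<omega>. card {y \<in> g \<omega>. Q \<omega> y \<and> y \<in> B}) = (\<lambda>\<omega>. card ({y \<in> g \<omega>. Q \<omega> y} \<inter> B))"
    by (auto intro!: ext arg_cong[where f = card])
  finally show "(\<lambda>\<omega>. card ({y \<in> g \<omega>. Q \<omega> y} \<inter> B)) \<in> measurable M (count_space UNIV)" .
qed

lemma measurable_Diff_point [measurable (raw)]:
  fixes g :: "'b \<Rightarrow> 'a::euclidean_space set"
  assumes g[measurable]: "g \<in> measurable M config_space" and f[measurable]: "f \<in> borel_measurable M"
  shows "(\<lambda>\<omega>. g \<omega> - {f \<omega>}) \<in> measurable M config_space"
proof -
  have "(\<lambda>\<omega>. {y \<in> g \<omega>. y \<noteq> f \<omega>}) \<in> measurable M config_space"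
    by (rule measurable_config_filter[OF g]) measurable
  also have "(\<lambda>\<omega>. {y \<in> g \<omega>. y \<noteq> f \<omega>}) = (\<lambda>\<omega>. g \<omega> - {f \<omega>})" by auto
  finally show ?thesis .
qed

lemma measurable_insert_point [measurable (raw)]:
  fixes g :: "'b \<Rightarrow> 'a::euclidean_space set"
  assumes g[measurable]: "g \<in> measurable M config_space" and f[measurable]: "f \<in> borel_measurable M"
  shows "(\<lambda>\<omega>. insert (f \<omega>) (g \<omega>)) \<in> measurable M config_space"
proof (rule measurable_config_spaceI)
  have gc: "g \<omega> \<in> configs" if "\<omega> \<in> space M" for \<omega>
    using measurable_space[OF g that] by (simp add: space_config_space)
  then show "insert (f \<omega>) (g \<omega>) \<in> configs" if "\<omega> \<in> space M" for \<omega>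
    using that by (intro configs_insert)
  fix B :: "'a set" assume B[measurable]: "B \<in> sets borel" and bB: "bounded B"
  have [measurable]: "(\<lambda>\<omega>. card ((g \<omega> - {f \<omega>}) \<inter> B)) \<in> measurable M (count_space UNIV)"
    by (rule measurable_compose[OF measurable_Diff_point[OF g f] measurable_card_Int[OF B bB]])
  have "(\<lambda>\<omega>. (if f \<omega> \<in> B then 1 else 0) + card ((g \<omega> - {f \<omega>}) \<inter> B)) \<in> measurable M (count_space UNIV)"
    by measurable
  also have "?this \<longleftrightarrow> (\<lambda>\<omega>. card (insert (f \<omega>) (g \<omega>) \<inter> B)) \<in> measurable M (count_space UNIV)"
  proof (rule measurable_cong)
    fix \<omega> assume \<omega>: "\<omega> \<in> space M"
    have "finite ((g \<omega> - {f \<omega>}) \<inter> B)"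
      using finite_config_Int[OF configs_Diff[OF gc[OF \<omega>]] bB] .
    moreover have "insert (f \<omega>) (g \<omega>) \<inter> B =
      (if f \<omega> \<in> B then insert (f \<omega>) ((g \<omega> - {f \<omega>}) \<inter> B) else (g \<omega> - {f \<omega>}) \<inter> B)" by auto
    ultimately show "(if f \<omega> \<in> B then 1 else 0) + card ((g \<omega> - {f \<omega>}) \<inter> B) = card (insert (f \<omega>) (g \<omega>) \<inter> B)"
      by auto
  qed
  finally show "(\<lambda>\<omega>. card (insert (f \<omega>) (g \<omega>) \<inter> B)) \<in> measurable M (count_space UNIV)" .
qed

lemma card_shift_Int:
  fixes \<gamma> :: "'a::real_normed_vector set"
  shows "card ((\<lambda>x. u + x) ` \<gamma> \<inter> B) = card (\<gamma> \<inter> (\<lambda>x. u + x) -` B)"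
proof -
  have "(\<lambda>x. u + x) ` \<gamma> \<inter> B = (\<lambda>x. u + x) ` (\<gamma> \<inter> (\<lambda>x. u + x) -` B)" by auto
  then show ?thesis by (simp add: card_image)
qed

lemma bounded_shift_vimage:
  fixes B :: "'a::real_normed_vector set"
  assumes "bounded B" shows "bounded ((\<lambda>x. u + x) -` B)"
proof -
  have "(\<lambda>x. u + x) -` B = (\<lambda>x. - u + x) ` B" by force
  then show ?thesis using bounded_translation[OF assms, of "- u"] by (simp only:)
qed

lemma configs_shift:
  fixes \<gamma> :: "'a::real_normed_vector set"
  assumes "\<gamma> \<in> configs" shows "(\<lambda>x. u + x) ` \<gamma> \<in> configs"
proof -
  have "(\<lambda>x. u + x) ` \<gamma> \<inter> B = (\<lambda>x. u + x) ` (\<gamma> \<inter> (\<lambda>x. u + x) -` B)" for B by auto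
  then show ?thesis
    using finite_config_Int[OF assms bounded_shift_vimage, of _ u] by (auto simp: configs_def)
qed

lemma measurable_shift:
  "(\<lambda>\<gamma>. (\<lambda>x. u + x) ` \<gamma>) \<in> measurable config_space (config_space :: 'a::euclidean_space set measure)"
proof (rule measurable_config_spaceI)
  show "(\<lambda>x. u + x) ` \<gamma> \<in> configs" if "\<gamma> \<in> space config_space" for \<gamma> :: "'a set"
    using that configs_shift by (simp add: space_config_space)
  fix B :: "'a set" assume B[measurable]: "B \<in> sets borel" and bB: "bounded B"
  have "(\<lambda>x. u + x) -` B \<in> sets borel"
    using measurable_sets[of "\<lambda>x. u + x" borel borel B] by simp
  then show "(\<lambda>\<gamma>. card ((\<lambda>x. u + x) ` \<gamma> \<inter> B)) \<in> measurable config_space (count_space UNIV)"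
    unfolding card_shift_Int by (rule measurable_card_Int[OF _ bounded_shift_vimage[OF bB]])
qed

lemma sum_points_filter:
  assumes "finite {y \<in> \<gamma>. Q y}"
  shows "(\<integral>\<^sup>+y. (if Q y then F y else 0) \<partial>count_space \<gamma>) = (\<Sum>y \<in> {y \<in> \<gamma>. Q y}. F y)"
  by (subst nn_integral_count_space'[OF assms]) (auto intro!: sum.cong)

lemma sum_points_remove:
  assumes "x \<in> \<gamma>"
  shows "(\<integral>\<^sup>+y. F y \<partial>count_space \<gamma>) = F x + (\<integral>\<^sup>+y. F y \<partial>count_space (\<gamma> - {x}))"
proof -
  have "(\<integral>\<^sup>+y. F y \<partial>count_space \<gamma>) = (\<integral>\<^sup>+y. F y * indicator {x} y + F y * indicator (- {x}) y \<partial>count_space \<gamma>)"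
    by (intro nn_integral_cong) (auto split: split_indicator)
  also have "\<dots> = (\<integral>\<^sup>+y. F y * indicator {x} y \<partial>count_space \<gamma>) + (\<integral>\<^sup>+y. F y * indicator (- {x}) y \<partial>count_space \<gamma>)"
    by (rule nn_integral_add) auto
  also have "(\<integral>\<^sup>+y. F y * indicator {x} y \<partial>count_space \<gamma>) = F x"
    using assms by (subst nn_integral_indicator_singleton) auto
  also have "(\<integral>\<^sup>+y. F y * indicator (- {x}) y \<partial>count_space \<gamma>) = (\<integral>\<^sup>+y. F y \<partial>count_space (\<gamma> - {x}))"
    by (subst (1 2) nn_integral_count_space_indicator) (auto intro!: nn_integral_cong split: split_indicator)
  finally show ?thesis .
qed

lemma nn_integral_sum_points_swap:
  assumes "countable \<gamma>" "sigma_finite_measure M" "\<And>x. x \<in> \<gamma> \<Longrightarrow> F x \<in> borel_measurable M"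
  shows "(\<integral>\<^sup>+y. (\<integral>\<^sup>+x. F x y \<partial>count_space \<gamma>) \<partial>M) = (\<integral>\<^sup>+x. (\<integral>\<^sup>+y. F x y \<partial>M) \<partial>count_space \<gamma>)"
proof -
  interpret M: sigma_finite_measure M by fact
  interpret C: sigma_finite_measure "count_space \<gamma>"
    by (rule sigma_finite_measure_count_space_countable) fact
  interpret pair_sigma_finite "count_space \<gamma>" M ..
  show ?thesis
    by (rule Fubini') (use assms in \<open>auto intro!: measurable_pair_measure_countable1\<close>)
qed

lemma measurable_case_prod_app:
  assumes f: "case_prod f \<in> measurable (A \<Otimes>\<^sub>M B) C"
    and u: "u \<in> measurable M A" and h: "h \<in> measurable M B"
  shows "(\<lambda>\<omega>. f (u \<omega>) (h \<omega>)) \<in> measurable M C"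
  using measurable_compose[OF measurable_Pair[OF u h] f] by simp

text \<open>In this form, membership in a ball with a moving centre is a measurable condition on a distance.\<close>

lemma indicator_ball: "indicator (ball x r) y = (if dist x y < r then 1 else 0 :: ennreal)"
  by (auto split: split_indicator)

lemma indicator_Compl_ball: "indicator (- ball x r) y = (if dist x y < r then 0 else 1 :: ennreal)"
  by (auto split: split_indicator)

section \<open>Stationary processes\<close>

lemma stationary_emeasure:
  fixes P :: "'a::euclidean_space set measure"
  assumes P: "stationary P" and A: "A \<in> sets config_space"
  shows "emeasure P {\<gamma> \<in> configs. (\<lambda>x. u + x) ` \<gamma> \<in> A} = emeasure P A"
proof -
  have s: "sets P = sets config_space" and d: "distr P config_space (\<lambda>\<gamma>. (\<lambda>x. u + x) ` \<gamma>) = P"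
    using P by (auto simp: stationary_def point_process_def)
  have m: "(\<lambda>\<gamma>. (\<lambda>x. u + x) ` \<gamma>) \<in> measurable P config_space"
    using measurable_shift measurable_cong_sets[OF s refl] by blast
  have "emeasure P A = emeasure (distr P config_space (\<lambda>\<gamma>. (\<lambda>x. u + x) ` \<gamma>)) A" by (simp add: d)
  also have "\<dots> = emeasure P ((\<lambda>\<gamma>. (\<lambda>x. u + x) ` \<gamma>) -` A \<inter> space P)"
    using m A by (rule emeasure_distr)
  also have "(\<lambda>\<gamma>. (\<lambda>x. u + x) ` \<gamma>) -` A \<inter> space P = {\<gamma> \<in> configs. (\<lambda>x. u + x) ` \<gamma> \<in> A}"
    using sets_eq_imp_space_eq[OF s] by (auto simp: space_config_space)
  finally show ?thesis by simp
qed

lemma stationary_nn_integral: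
  fixes P :: "'a::euclidean_space set measure"
  assumes P: "stationary P" and F: "F \<in> borel_measurable config_space"
  shows "(\<integral>\<^sup>+\<gamma>. F ((\<lambda>x. u + x) ` \<gamma>) \<partial>P) = (\<integral>\<^sup>+\<gamma>. F \<gamma> \<partial>P)"
proof -
  have s: "sets P = sets config_space" and d: "distr P config_space (\<lambda>\<gamma>. (\<lambda>x. u + x) ` \<gamma>) = P"
    using P by (auto simp: stationary_def point_process_def)
  have m: "(\<lambda>\<gamma>. (\<lambda>x. u + x) ` \<gamma>) \<in> measurable P config_space"
    using measurable_shift measurable_cong_sets[OF s refl] by blast
  have "(\<integral>\<^sup>+\<gamma>. F \<gamma> \<partial>P) = (\<integral>\<^sup>+\<gamma>. F \<gamma> \<partial>distr P config_space (\<lambda>\<gamma>. (\<lambda>x. u + x) ` \<gamma>))" by (simp add: d)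
  also have "\<dots> = (\<integral>\<^sup>+\<gamma>. F ((\<lambda>x. u + x) ` \<gamma>) \<partial>P)"
    using m F by (subst nn_integral_distr) auto
  finally show ?thesis by simp
qed

text \<open>A nonempty configuration inside a ball of radius \<open>n\<close> is not inside the translates of that ball by
  the nonzero multiples of \<open>2 n\<close> in a fixed direction. The corresponding events are disjoint and equally
  likely, hence null.\<close>

lemma stationary_finite_nonempty_null:
  fixes P :: "'a::euclidean_space set measure"
  assumes P: "stationary P"
  shows "AE \<gamma> in P. finite \<gamma> \<longrightarrow> \<gamma> = {}"
proof -
  have s: "sets P = sets config_space" and pp: "prob_space P"
    using P by (auto simp: stationary_def point_process_def)
  interpret prob_space P by (rule pp)
  have sp: "space P = configs" using sets_eq_imp_space_eq[OF s] by (simp add: space_config_space)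
  define F where "F n = {\<gamma> \<in> configs. \<gamma> \<noteq> {} \<and> \<gamma> \<subseteq> ball (0::'a) (real n)}" for n
  have F_sets: "F n \<in> sets config_space" for n
  proof -
    have [measurable]: "(\<lambda>\<gamma>. \<integral>\<^sup>+y. indicator C y \<partial>count_space \<gamma>) \<in> borel_measurable config_space"
      if [measurable]: "C \<in> sets borel" for C :: "'a set"
      by (rule measurable_sum_points) auto
    have zero: "(\<integral>\<^sup>+y. indicator C y \<partial>count_space \<gamma>) = 0 \<longleftrightarrow> \<gamma> \<inter> C = {}" for C \<gamma> :: "'a set"
      by (auto simp: nn_integral_0_iff_AE AE_count_space indicator_eq_0_iff)
    have "F n = {\<gamma> \<in> space config_space. (\<integral>\<^sup>+y. indicator (- ball 0 (real n)) y \<partial>count_space \<gamma>) = 0 \<and>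
        (\<integral>\<^sup>+y. indicator UNIV y \<partial>count_space \<gamma>) \<noteq> 0}"
      unfolding F_def space_config_space zero by auto
    also have "\<dots> \<in> sets config_space" by measurable
    finally show ?thesis .
  qed
  have null: "emeasure P (F n) = 0" for n
  proof -
    obtain e :: 'a where e: "norm e = 1" using vector_choose_size[of 1] by auto
    define u where "u j = (2 * real n * real j) *\<^sub>R e" for j :: nat
    define T where "T j = {\<gamma> \<in> configs. (\<lambda>x. u j + x) ` \<gamma> \<in> F n}" for j
    have Ts: "T j \<in> sets P" for j
    proof -
      have "T j = (\<lambda>\<gamma>. (\<lambda>x. u j + x) ` \<gamma>) -` F n \<inter> space config_space"
        by (auto simp: T_def space_config_space)
      then show ?thesis using measurable_sets[OF measurable_shift F_sets] s by simp
    qed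
    have "disjoint_family T"
      unfolding disjoint_family_on_def
    proof (intro ballI impI)
      fix i j :: nat assume "i \<noteq> j"
      show "T i \<inter> T j = {}"
      proof (rule ccontr)
        assume "T i \<inter> T j \<noteq> {}"
        then obtain \<gamma> where g: "\<gamma> \<in> T i" "\<gamma> \<in> T j" by auto
        then obtain x where "x \<in> \<gamma>" by (auto simp: T_def F_def)
        then have x: "norm (u i + x) < real n" "norm (u j + x) < real n"
          using g by (auto simp: T_def F_def)
        have "norm (u i - u j) \<le> norm (u i + x) + norm (u j + x)"
          using norm_triangle_ineq4[of "u i + x" "u j + x"] by simp
        then have "norm (u i - u j) < 2 * real n" using x by linarith
        moreover have "u i - u j = (2 * real n * (real i - real j)) *\<^sub>R e"
          by (simp add: u_def algebra_simps)
        then have "norm (u i - u j) = 2 * real n * \<bar>real i - real j\<bar>"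
          using e by (simp add: abs_mult)
        moreover have "1 \<le> \<bar>real i - real j\<bar>" using \<open>i \<noteq> j\<close> by linarith
        ultimately show False
          using mult_left_mono[of 1 "\<bar>real i - real j\<bar>" "2 * real n"] by simp
      qed
    qed
    then have "(\<lambda>j. measure P (T j)) sums measure P (\<Union>j. T j)"
      using Ts by (intro finite_measure_UNION) auto
    moreover have "measure P (T j) = measure P (F n)" for j
      using stationary_emeasure[OF P F_sets] by (simp add: measure_def T_def)
    ultimately have "summable (\<lambda>j::nat. measure P (F n))" by (simp add: sums_iff)
    then have "(\<lambda>j::nat. measure P (F n)) \<longlonglongrightarrow> 0" by (rule summable_LIMSEQ_zero)
    then show ?thesis by (simp add: emeasure_eq_measure LIMSEQ_const_iff)
  qed
  have "AE \<gamma> in P. \<forall>n. \<gamma> \<notin> F n"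
    unfolding AE_all_countable
    using null F_sets s by (auto intro!: AE_not_in null_setsI)
  then show ?thesis
  proof (eventually_elim, intro impI)
    fix \<gamma> assume "\<forall>n. \<gamma> \<notin> F n" "finite \<gamma>"
    then obtain r where "\<forall>x\<in>\<gamma>. norm x \<le> r" using finite_imp_bounded[of \<gamma>] by (auto simp: bounded_iff)
    moreover obtain n where "r < real n" using reals_Archimedean2 by blast
    ultimately have "\<gamma> \<subseteq> ball 0 (real n)" by force
    moreover have "\<gamma> \<in> configs" using \<open>finite \<gamma>\<close> by (auto simp: configs_def)
    ultimately show "\<gamma> = {}" using \<open>\<forall>n. \<gamma> \<notin> F n\<close> by (auto simp: F_def)
  qed
qed

text \<open>The mean measure is translation invariant. Averaging the mean number of points in
  \<open>\<Lambda> - u\<close> over \<open>u\<close> in the unit ball and exchanging the order of integration identifies it as a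
  multiple of Lebesgue measure.\<close>

lemma stationary_intensity:
  fixes P :: "'a::euclidean_space set measure"
  assumes P: "stationary P" and \<Lambda>: "\<Lambda> \<in> sets borel"
  defines "mean B \<equiv> \<integral>\<^sup>+\<gamma>. (\<integral>\<^sup>+x. indicator B x \<partial>count_space \<gamma>) \<partial>P"
  shows "mean \<Lambda> * emeasure lborel (ball (0::'a) 1) = emeasure lborel \<Lambda> * mean (ball 0 1)"
proof -
  have s[measurable_cong]: "sets P = sets config_space" and pp: "prob_space P"
    using P by (auto simp: stationary_def point_process_def)
  interpret prob_space P by (rule pp)
  have sp: "space P = configs" using sets_eq_imp_space_eq[OF s] by (simp add: space_config_space)
  define B where "B = ball (0::'a) 1"
  have [measurable]: "B \<in> sets borel" by (simp add: B_def)
  note [measurable] = \<Lambda>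
  have id_meas[measurable]: "(\<lambda>\<gamma>. \<gamma>) \<in> measurable P config_space"
    by (rule measurable_ident_sets[OF s])
  have mshift: "mean C = (\<integral>\<^sup>+\<gamma>. (\<integral>\<^sup>+x. indicator C (u + x) \<partial>count_space \<gamma>) \<partial>P)"
    if [measurable]: "C \<in> sets borel" for C and u :: 'a
  proof -
    have "(\<integral>\<^sup>+\<gamma>. (\<integral>\<^sup>+x. indicator C x \<partial>count_space ((\<lambda>x. u + x) ` \<gamma>)) \<partial>P) = mean C"
      unfolding mean_def
      by (rule stationary_nn_integral[OF P]) (auto intro!: measurable_sum_points)
    moreover have "(\<integral>\<^sup>+x. indicator C x \<partial>count_space ((\<lambda>x. u + x) ` \<gamma>)) =
      (\<integral>\<^sup>+x. indicator C (u + x) \<partial>count_space \<gamma>)" for \<gamma>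
      by (rule nn_integral_bij_count_space[symmetric]) (auto simp: bij_betw_def)
    ultimately show ?thesis by simp
  qed
  have pair: "pair_sigma_finite P lborel" ..
  have "mean \<Lambda> * emeasure lborel B = (\<integral>\<^sup>+u. mean \<Lambda> * indicator B u \<partial>lborel)"
    by (simp add: nn_integral_cmult_indicator)
  also have "\<dots> = (\<integral>\<^sup>+u. (\<integral>\<^sup>+\<gamma>. (\<integral>\<^sup>+x. indicator \<Lambda> (u + x) * indicator B u \<partial>count_space \<gamma>) \<partial>P) \<partial>lborel)"
  proof (rule nn_integral_cong)
    fix u :: 'a
    have "mean \<Lambda> * indicator B u = (\<integral>\<^sup>+\<gamma>. (\<integral>\<^sup>+x. indicator \<Lambda> (u + x) \<partial>count_space \<gamma>) * indicator B u \<partial>P)"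
      unfolding mshift[OF \<Lambda>, of u]
      by (rule nn_integral_multc[symmetric], rule measurable_sum_points[OF id_meas]) measurable
    then show "mean \<Lambda> * indicator B u = (\<integral>\<^sup>+\<gamma>. (\<integral>\<^sup>+x. indicator \<Lambda> (u + x) * indicator B u \<partial>count_space \<gamma>) \<partial>P)"
      by (simp add: nn_integral_multc)
  qed
  also have "\<dots> = (\<integral>\<^sup>+\<gamma>. (\<integral>\<^sup>+u. (\<integral>\<^sup>+x. indicator \<Lambda> (u + x) * indicator B u \<partial>count_space \<gamma>) \<partial>lborel) \<partial>P)"
    by (rule pair_sigma_finite.Fubini'[OF pair])
      (unfold case_prod_unfold, rule measurable_sum_points, measurable)
  also have "\<dots> = (\<integral>\<^sup>+\<gamma>. (\<integral>\<^sup>+w. (\<integral>\<^sup>+x. indicator \<Lambda> w * indicator B (w - x) \<partial>count_space \<gamma>) \<partial>lborel) \<partial>P)"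
  proof (rule nn_integral_cong)
    fix \<gamma> assume "\<gamma> \<in> space P"
    then have c: "countable \<gamma>" using sp configs_countable by auto
    have "(\<integral>\<^sup>+u. (\<integral>\<^sup>+x. indicator \<Lambda> (u + x) * indicator B u \<partial>count_space \<gamma>) \<partial>lborel) =
      (\<integral>\<^sup>+x. (\<integral>\<^sup>+u. indicator \<Lambda> (u + x) * indicator B u \<partial>lborel) \<partial>count_space \<gamma>)"
      by (rule nn_integral_sum_points_swap[OF c]) (auto intro: lborel.sigma_finite_measure_axioms)
    also have "\<dots> = (\<integral>\<^sup>+x. (\<integral>\<^sup>+w. indicator \<Lambda> w * indicator B (w - x) \<partial>lborel) \<partial>count_space \<gamma>)"
    proof (rule nn_integral_cong)
      fix x
      have "(\<integral>\<^sup>+w. indicator \<Lambda> w * indicator B (w - x) \<partial>lborel) =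
        (\<integral>\<^sup>+w. indicator \<Lambda> w * indicator B (w - x) \<partial>distr lborel borel (\<lambda>u. x + u))"
        by (simp add: lborel_distr_plus)
      also have "\<dots> = (\<integral>\<^sup>+u. indicator \<Lambda> (u + x) * indicator B u \<partial>lborel)"
        by (subst nn_integral_distr) (auto simp: add.commute)
      finally show "(\<integral>\<^sup>+u. indicator \<Lambda> (u + x) * indicator B u \<partial>lborel) =
        (\<integral>\<^sup>+w. (indicator \<Lambda> w * indicator B (w - x) :: ennreal) \<partial>lborel)" by simp
    qed
    also have "\<dots> = (\<integral>\<^sup>+w. (\<integral>\<^sup>+x. indicator \<Lambda> w * indicator B (w - x) \<partial>count_space \<gamma>) \<partial>lborel)"
      by (rule nn_integral_sum_points_swap[OF c, symmetric]) (auto intro: lborel.sigma_finite_measure_axioms)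
    finally show "(\<integral>\<^sup>+u. (\<integral>\<^sup>+x. indicator \<Lambda> (u + x) * indicator B u \<partial>count_space \<gamma>) \<partial>lborel) =
      (\<integral>\<^sup>+w. (\<integral>\<^sup>+x. (indicator \<Lambda> w * indicator B (w - x) :: ennreal) \<partial>count_space \<gamma>) \<partial>lborel)" .
  qed
  also have "\<dots> = (\<integral>\<^sup>+w. (\<integral>\<^sup>+\<gamma>. (\<integral>\<^sup>+x. indicator \<Lambda> w * indicator B (w - x) \<partial>count_space \<gamma>) \<partial>P) \<partial>lborel)"
    by (rule pair_sigma_finite.Fubini'[OF pair, symmetric])
      (unfold case_prod_unfold, rule measurable_sum_points, measurable)
  also have "\<dots> = (\<integral>\<^sup>+w. indicator \<Lambda> w * mean B \<partial>lborel)"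
  proof (rule nn_integral_cong)
    fix w :: 'a
    have "indicator B (w - x) = (indicator B (- w + x) :: ennreal)" for x
      by (simp add: B_def indicator_def norm_minus_commute)
    then have "mean B = (\<integral>\<^sup>+\<gamma>. (\<integral>\<^sup>+x. indicator B (w - x) \<partial>count_space \<gamma>) \<partial>P)"
      using mshift[of B "- w"] by simp
    then have "indicator \<Lambda> w * mean B = (\<integral>\<^sup>+\<gamma>. indicator \<Lambda> w * (\<integral>\<^sup>+x. indicator B (w - x) \<partial>count_space \<gamma>) \<partial>P)"
      by (simp only:) (rule nn_integral_cmult[symmetric], rule measurable_sum_points[OF id_meas], measurable)
    then show "(\<integral>\<^sup>+\<gamma>. (\<integral>\<^sup>+x. indicator \<Lambda> w * indicator B (w - x) \<partial>count_space \<gamma>) \<partial>P) = indicator \<Lambda> w * mean B"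
      by (simp add: nn_integral_cmult)
  qed
  also have "\<dots> = emeasure lborel \<Lambda> * mean B"
    by (simp add: nn_integral_multc)
  finally show ?thesis by (simp only: B_def)
qed

section \<open>Gibbs processes with bounded Papangelou intensity\<close>

locale gibbs_process =
  fixes P :: "'a::euclidean_space set measure" and lam :: "'a \<Rightarrow> 'a set \<Rightarrow> ennreal" and z :: real
  assumes gibbs: "gibbs lam P"
    and lam_le: "\<And>x \<gamma>. \<gamma> \<in> configs \<Longrightarrow> lam x \<gamma> \<le> ennreal z"
    and z_pos: "z > 0"
begin

lemma sets_P [measurable_cong]: "sets P = sets config_space"
  using gibbs by (simp add: gibbs_def point_process_def)

lemma space_P: "space P = configs"
  using sets_eq_imp_space_eq[OF sets_P] by (simp add: space_config_space)

sublocale prob_space P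
  using gibbs by (simp add: gibbs_def point_process_def)

sublocale pair_sigma_finite P lborel ..

lemma measurable_ident_P: "(\<lambda>\<gamma>. \<gamma>) \<in> measurable P config_space"
  by (rule measurable_ident_sets[OF sets_P])

lemma gnz:
  assumes F: "case_prod F \<in> borel_measurable (borel \<Otimes>\<^sub>M config_space)"
  shows "(\<integral>\<^sup>+\<gamma>. (\<integral>\<^sup>+x. F x (\<gamma> - {x}) \<partial>count_space \<gamma>) \<partial>P) =
         (\<integral>\<^sup>+\<gamma>. (\<integral>\<^sup>+x. F x \<gamma> * lam x \<gamma> \<partial>lborel) \<partial>P)"
proof -
  have "(\<integral>\<^sup>+\<gamma>. (\<integral>\<^sup>+x. case_prod F (x, \<gamma> - {x}) \<partial>count_space \<gamma>) \<partial>P) =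
         (\<integral>\<^sup>+\<gamma>. (\<integral>\<^sup>+x. case_prod F (x, \<gamma>) * lam x \<gamma> \<partial>lborel) \<partial>P)"
    using gibbs F unfolding gibbs_def by blast
  then show ?thesis by simp
qed

lemma intensity_le:
  assumes [measurable]: "B \<in> sets borel"
  shows "(\<integral>\<^sup>+\<gamma>. (\<integral>\<^sup>+x. indicator B x \<partial>count_space \<gamma>) \<partial>P) \<le> ennreal z * emeasure lborel B"
proof -
  have "(\<integral>\<^sup>+\<gamma>. (\<integral>\<^sup>+x. indicator B x \<partial>count_space \<gamma>) \<partial>P) =
    (\<integral>\<^sup>+\<gamma>. (\<integral>\<^sup>+x. indicator B x * lam x \<gamma> \<partial>lborel) \<partial>P)"
    by (rule gnz) measurable
  also have "\<dots> \<le> (\<integral>\<^sup>+\<gamma>. (\<integral>\<^sup>+x. ennreal z * indicator B x \<partial>lborel) \<partial>P)"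
    using lam_le by (intro nn_integral_mono) (auto simp: space_P split: split_indicator)
  also have "\<dots> = ennreal z * emeasure lborel B"
    by (simp add: nn_integral_cmult_indicator emeasure_space_1)
  finally show ?thesis .
qed

text \<open>Finite nonempty configurations have probability 0 by stationarity, so only the empty one is left to
  exclude. Test the Gibbs equation with the event that nothing else is present: the sum over the
  points vanishes, because there are almost surely no single-point configurations, while the other
  side is \<open>z\<close> times the volume of the test ball times the probability of the empty configuration.\<close>

lemma stationary_infinite:
  assumes st: "stationary P" and empty: "\<And>x. lam x {} = ennreal z"
  shows "AE \<gamma> in P. infinite \<gamma>"
proof -
  have [measurable]: "(\<lambda>\<gamma>. \<integral>\<^sup>+y. indicator (UNIV :: 'a set) y \<partial>count_space \<gamma>) \<in> borel_measurable config_space"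
    by (rule measurable_sum_points) auto
  have empty_eq: "\<gamma> = {} \<longleftrightarrow> (\<integral>\<^sup>+y. indicator (UNIV :: 'a set) y \<partial>count_space \<gamma>) = 0" for \<gamma> :: "'a set"
    by (subst nn_integral_0_iff_AE) (auto simp: AE_count_space)
  have [measurable]: "Measurable.pred config_space (\<lambda>\<gamma> :: 'a set. \<gamma> = {})"
    unfolding empty_eq by measurable
  have [measurable]: "{} \<in> sets (config_space :: 'a set measure)" by simp
  define F where "F x \<gamma> = (if \<gamma> = {} then indicator (ball 0 1) x else 0 :: ennreal)" for x :: 'a and \<gamma> :: "'a set"
  have "(\<integral>\<^sup>+\<gamma>. (\<integral>\<^sup>+x. F x (\<gamma> - {x}) \<partial>count_space \<gamma>) \<partial>P) = 0"
  proof (subst nn_integral_0_iff_AE)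
    show "(\<lambda>\<gamma>. \<integral>\<^sup>+x. F x (\<gamma> - {x}) \<partial>count_space \<gamma>) \<in> borel_measurable P"
      unfolding F_def indicator_ball by (rule measurable_sum_points[OF measurable_ident_P]) measurable
    show "AE \<gamma> in P. (\<integral>\<^sup>+x. F x (\<gamma> - {x}) \<partial>count_space \<gamma>) = 0"
      using stationary_finite_nonempty_null[OF st]
    proof eventually_elim
      fix \<gamma> :: "'a set" assume "finite \<gamma> \<longrightarrow> \<gamma> = {}"
      then have "\<gamma> - {x} \<noteq> {}" if "x \<in> \<gamma>" for x
        using that finite_subset[of \<gamma> "{x}"] by auto
      then show "(\<integral>\<^sup>+x. F x (\<gamma> - {x}) \<partial>count_space \<gamma>) = 0"
        by (subst nn_integral_0_iff_AE) (auto simp: F_def AE_count_space)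
    qed
  qed
  moreover have "(\<integral>\<^sup>+\<gamma>. (\<integral>\<^sup>+x. F x (\<gamma> - {x}) \<partial>count_space \<gamma>) \<partial>P) =
    (\<integral>\<^sup>+\<gamma>. (\<integral>\<^sup>+x. F x \<gamma> * lam x \<gamma> \<partial>lborel) \<partial>P)"
    by (rule gnz) (unfold F_def indicator_ball, measurable)
  moreover have "(\<integral>\<^sup>+x. F x \<gamma> * lam x \<gamma> \<partial>lborel) =
    (if \<gamma> = {} then ennreal z * emeasure lborel (ball (0::'a) 1) else 0)" for \<gamma>
    by (cases "\<gamma> = {}") (simp_all add: F_def empty mult.commute[of _ "ennreal z"] nn_integral_cmult_indicator)
  ultimately have "(\<integral>\<^sup>+\<gamma>. (if \<gamma> = {} then ennreal z * emeasure lborel (ball (0::'a) 1) else 0) \<partial>P) = 0"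
    by simp
  then have "AE \<gamma> in P. (if \<gamma> = {} then ennreal z * emeasure lborel (ball (0::'a) 1) else 0) = 0"
    by (subst (asm) nn_integral_0_iff_AE) simp_all
  moreover have "ennreal z * emeasure lborel (ball (0::'a) 1) \<noteq> 0"
    using z_pos less_imp_neq[OF unit_ball_vol_pos[of "real DIM('a)", OF of_nat_0_le_iff], THEN not_sym]
    by (simp add: emeasure_ball)
  ultimately have "AE \<gamma> in P. \<gamma> \<noteq> {}" by (auto split: if_splits)
  with stationary_finite_nonempty_null[OF st] show ?thesis by eventually_elim auto
qed

text \<open>By \<open>stationary_intensity\<close> the mean measure is a multiple of Lebesgue measure; the factor is finite
  because the Papangelou intensity is bounded, and positive because there are points.\<close>

lemma stationary_density:
  assumes st: "stationary P" and inf: "AE \<gamma> in P. infinite \<gamma>"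
  obtains \<rho> :: real where "\<rho> > 0" "\<And>\<Lambda>. \<Lambda> \<in> sets borel \<Longrightarrow>
    (\<integral>\<^sup>+\<gamma>. (\<integral>\<^sup>+x. indicator \<Lambda> x \<partial>count_space \<gamma>) \<partial>P) = ennreal \<rho> * emeasure lborel \<Lambda>"
proof -
  define mean where "mean \<Lambda> = (\<integral>\<^sup>+\<gamma>. (\<integral>\<^sup>+x. indicator \<Lambda> x \<partial>count_space \<gamma>) \<partial>P)" for \<Lambda> :: "'a set"
  define w where "w = unit_ball_vol (real DIM('a))"
  have w: "w > 0" "emeasure lborel (ball (0::'a) 1) = ennreal w"
    by (auto simp: w_def emeasure_ball unit_ball_vol_pos)
  have "mean (ball 0 1) \<le> ennreal z * ennreal w"
    using intensity_le[of "ball 0 1"] unfolding mean_def w(2) by simp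
  also have "\<dots> < top" by (simp add: ennreal_mult_less_top)
  finally obtain m where m: "mean (ball 0 1) = ennreal m" "m \<ge> 0" by (cases "mean (ball 0 1)") auto
  have mean: "mean \<Lambda> = ennreal (m / w) * emeasure lborel \<Lambda>" if "\<Lambda> \<in> sets borel" for \<Lambda>
  proof -
    have "mean \<Lambda> * ennreal w = emeasure lborel \<Lambda> * ennreal m"
      using stationary_intensity[OF st that] unfolding mean_def[symmetric] w(2) m(1) .
    then have "mean \<Lambda> * (ennreal w * ennreal (1 / w)) = emeasure lborel \<Lambda> * (ennreal m * ennreal (1 / w))"
      by (simp only: mult.assoc[symmetric])
    then show ?thesis using w(1) m(2) by (simp add: ennreal_mult[symmetric] mult.commute)
  qed
  have "m \<noteq> 0"
  proof
    assume "m = 0"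
    then have "mean UNIV = 0" using mean[of UNIV] by simp
    moreover have "(\<lambda>\<gamma>. \<integral>\<^sup>+x. indicator (UNIV :: 'a set) x \<partial>count_space \<gamma>) \<in> borel_measurable P"
      by (rule measurable_sum_points[OF measurable_ident_P]) auto
    ultimately have "AE \<gamma> in P. (\<integral>\<^sup>+x. indicator (UNIV :: 'a set) x \<partial>count_space \<gamma>) = 0"
      unfolding mean_def by (subst (asm) nn_integral_0_iff_AE)
    with inf have "AE \<gamma> in P. False"
      by eventually_elim (subst (asm) nn_integral_0_iff_AE, auto simp: AE_count_space)
    then show False by simp
  qed
  then show ?thesis using that[of "m / w"] mean m(2) w(1) by (simp add: mean_def)
qed

lemma stationary_few_points:
  fixes c :: 'a
  assumes st: "stationary P"
  shows "emeasure P {\<gamma> \<in> configs. card (\<gamma> \<inter> ball c r) \<le> k} = emeasure P {\<gamma> \<in> configs. card (\<gamma> \<inter> ball 0 r) \<le> k}"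
proof -
  have [measurable]: "(\<lambda>\<gamma>. card (\<gamma> \<inter> ball (0::'a) r)) \<in> measurable config_space (count_space UNIV)"
    by (rule measurable_card_Int) auto
  have "{\<gamma> \<in> space config_space. card (\<gamma> \<inter> ball (0::'a) r) \<le> k} \<in> sets config_space" by measurable
  then have "{\<gamma> \<in> configs. card (\<gamma> \<inter> ball (0::'a) r) \<le> k} \<in> sets config_space" by (simp add: space_config_space)
  from stationary_emeasure[OF st this, of "- c"]
  have "emeasure P {\<gamma> \<in> configs. (\<lambda>x. - c + x) ` \<gamma> \<in> {\<gamma> \<in> configs. card (\<gamma> \<inter> ball 0 r) \<le> k}} =
    emeasure P {\<gamma> \<in> configs. card (\<gamma> \<inter> ball 0 r) \<le> k}" .
  moreover have "(\<lambda>x. - c + x) -` ball 0 r = ball c r" by (auto simp: dist_norm norm_minus_commute)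
  then have "{\<gamma> \<in> configs. (\<lambda>x. - c + x) ` \<gamma> \<in> {\<gamma> \<in> configs. card (\<gamma> \<inter> ball 0 r) \<le> k}} = {\<gamma> \<in> configs. card (\<gamma> \<inter> ball c r) \<le> k}"
    using configs_shift[of _ "- c"] card_shift_Int[of "- c" _ "ball 0 r"] by auto
  ultimately show ?thesis by simp
qed

lemma few_points_tendsto_0:
  assumes inf: "AE \<gamma> in P. infinite \<gamma>"
  shows "(\<lambda>n. measure P {\<gamma> \<in> configs. card (\<gamma> \<inter> ball (0::'a) (real n)) \<le> k}) \<longlonglongrightarrow> 0"
proof -
  let ?E = "\<lambda>n. {\<gamma> \<in> configs. card (\<gamma> \<inter> ball (0::'a) (real n)) \<le> k}"
  have sets: "?E n \<in> events" for n
  proof -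
    have [measurable]: "(\<lambda>\<gamma>. card (\<gamma> \<inter> ball (0::'a) (real n))) \<in> measurable config_space (count_space UNIV)"
      by (rule measurable_card_Int) auto
    have "{\<gamma> \<in> space config_space. card (\<gamma> \<inter> ball (0::'a) (real n)) \<le> k} \<in> sets config_space" by measurable
    then show ?thesis by (simp add: space_config_space sets_P)
  qed
  have "decseq ?E"
  proof (rule decseq_SucI, rule subsetI)
    fix n \<gamma> assume g: "\<gamma> \<in> ?E (Suc n)"
    have "card (\<gamma> \<inter> ball 0 (real n)) \<le> card (\<gamma> \<inter> ball 0 (real (Suc n)))"
      using g by (intro card_mono finite_config_Int) auto
    then show "\<gamma> \<in> ?E n" using g by auto
  qed
  then have "(\<lambda>n. prob (?E n)) \<longlonglongrightarrow> prob (\<Inter>n. ?E n)"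
    using sets by (intro finite_Lim_measure_decseq) auto
  moreover have "prob (\<Inter>n. ?E n) = 0"
  proof -
    have "AE \<gamma> in P. \<gamma> \<notin> (\<Inter>n. ?E n)"
      using inf
    proof eventually_elim
      fix \<gamma> :: "'a set" assume "infinite \<gamma>"
      then obtain B where B: "finite B" "B \<subseteq> \<gamma>" "card B = Suc k" using infinite_arbitrarily_large by blast
      then obtain r where "\<forall>x\<in>B. norm x \<le> r" using finite_imp_bounded[of B] by (auto simp: bounded_iff)
      moreover obtain n where "r < real n" using reals_Archimedean2 by blast
      ultimately have sub: "B \<subseteq> \<gamma> \<inter> ball 0 (real n)" using B(2) by force
      show "\<gamma> \<notin> (\<Inter>n. ?E n)"
      proof
        assume "\<gamma> \<in> (\<Inter>n. ?E n)"
        then have "\<gamma> \<in> ?E n" by blast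
        moreover from this have "card B \<le> card (\<gamma> \<inter> ball 0 (real n))"
          using sub by (intro card_mono finite_config_Int) auto
        ultimately show False using B(3) by simp
      qed
    qed
    moreover have "(\<Inter>n. ?E n) \<in> events" using sets by (intro sets.countable_INT) auto
    ultimately show ?thesis using prob_eq_0 by blast
  qed
  ultimately show ?thesis by simp
qed

end

section \<open>A variance bound from a local event\<close>

text \<open>For a pair \<open>(x, \<gamma>)\<close> in \<open>A\<close>, points at distance at least \<open>D\<close> from \<open>x\<close> influence neither the
  intensity at \<open>x\<close> nor the membership in \<open>A\<close> itself. Restricting attention to \<open>A\<close> thus replaces a
  finite range of the interaction.\<close>

locale gibbs_local_event = gibbs_process P lam z
  for P :: "'a::euclidean_space set measure" and lam and z +
  fixes A :: "('a \<times> 'a set) set" and D :: real and \<Lambda> :: "'a set"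
  assumes A_sets [measurable]: "A \<in> sets (borel \<Otimes>\<^sub>M config_space)"
    and lam_meas: "(\<lambda>(x, \<gamma>). indicator A (x, \<gamma>) * lam x \<gamma>) \<in> borel_measurable (borel \<Otimes>\<^sub>M config_space)"
    and D_nonneg: "D \<ge> 0"
    and A_local: "\<And>x y \<gamma>. \<gamma> \<in> configs \<Longrightarrow> dist x y \<ge> D \<Longrightarrow> (x, insert y \<gamma>) \<in> A \<longleftrightarrow> (x, \<gamma>) \<in> A"
    and lam_local: "\<And>x y \<gamma>. \<gamma> \<in> configs \<Longrightarrow> (x, \<gamma>) \<in> A \<Longrightarrow> dist x y \<ge> D \<Longrightarrow> lam x (insert y \<gamma>) = lam x \<gamma>"
    and \<Lambda>_sets [measurable]: "\<Lambda> \<in> sets borel"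
    and \<Lambda>_bounded: "bounded \<Lambda>"
begin

definition mark :: "'a \<Rightarrow> 'a set \<Rightarrow> ennreal"
  where "mark x \<gamma> = indicator \<Lambda> x * indicator A (x, \<gamma>)"

text \<open>The points of \<open>\<Lambda>\<close> at which \<open>A\<close> occurs are counted by \<open>marked_count\<close>. Its difference from
  \<open>compensator\<close> is the random variable with which \<open>N\<close> is compared: the Gibbs equation makes it
  centred and gives its covariance with \<open>N\<close>.\<close>

definition marked_count :: "'a set \<Rightarrow> ennreal"
  where "marked_count \<gamma> = (\<integral>\<^sup>+x. mark x (\<gamma> - {x}) \<partial>count_space \<gamma>)"

definition marked_intensity :: "'a \<Rightarrow> 'a set \<Rightarrow> ennreal"
  where "marked_intensity x \<gamma> = mark x \<gamma> * lam x \<gamma>"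

definition compensator :: "'a set \<Rightarrow> ennreal"
  where "compensator \<gamma> = (\<integral>\<^sup>+x. marked_intensity x \<gamma> \<partial>lborel)"

definition far_compensator :: "'a \<Rightarrow> 'a set \<Rightarrow> ennreal"
  where "far_compensator y \<gamma> = (\<integral>\<^sup>+x. indicator (- ball y D) x * marked_intensity x \<gamma> \<partial>lborel)"

text \<open>The contribution of pairs of locations at distance at least \<open>D\<close>, which is common to the second
  moments of \<open>marked_count\<close> and \<open>compensator\<close> and to their mixed moment.\<close>

definition far_pairs :: ennreal
  where "far_pairs = (\<integral>\<^sup>+\<gamma>. (\<integral>\<^sup>+y. marked_intensity y \<gamma> * far_compensator y \<gamma> \<partial>lborel) \<partial>P)"

abbreviation N :: "'a set \<Rightarrow> nat"
  where "N \<gamma> \<equiv> card (\<gamma> \<inter> \<Lambda>)"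

text \<open>The volume of a ball of radius \<open>D\<close>.\<close>

definition near_volume :: real
  where "near_volume = unit_ball_vol (real DIM('a)) * D ^ DIM('a)"

abbreviation vol :: ennreal
  where "vol \<equiv> emeasure lborel \<Lambda>"

lemma mark_meas: "case_prod mark \<in> borel_measurable (borel \<Otimes>\<^sub>M config_space)"
  unfolding mark_def by measurable

lemma mark_measurable [measurable (raw)]:
  "u \<in> borel_measurable M \<Longrightarrow> h \<in> measurable M config_space \<Longrightarrow> (\<lambda>\<omega>. mark (u \<omega>) (h \<omega>)) \<in> borel_measurable M"
  by (rule measurable_case_prod_app[OF mark_meas])

lemma marked_intensity_meas: "case_prod marked_intensity \<in> borel_measurable (borel \<Otimes>\<^sub>M config_space)"
proof -
  have "case_prod marked_intensity = (\<lambda>p. indicator \<Lambda> (fst p) * (case p of (x, \<gamma>) \<Rightarrow> indicator A (x, \<gamma>) * lam x \<gamma>))"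
    by (auto simp: marked_intensity_def mark_def mult.assoc)
  also have "\<dots> \<in> borel_measurable (borel \<Otimes>\<^sub>M config_space)"
    by (rule borel_measurable_times_ennreal[OF _ lam_meas]) measurable
  finally show ?thesis .
qed

lemma marked_intensity_measurable [measurable (raw)]:
  "u \<in> borel_measurable M \<Longrightarrow> h \<in> measurable M config_space \<Longrightarrow> (\<lambda>\<omega>. marked_intensity (u \<omega>) (h \<omega>)) \<in> borel_measurable M"
  by (rule measurable_case_prod_app[OF marked_intensity_meas])

lemma far_compensator_measurable [measurable (raw)]:
  assumes [measurable]: "u \<in> borel_measurable M" "h \<in> measurable M config_space"
  shows "(\<lambda>\<omega>. far_compensator (u \<omega>) (h \<omega>)) \<in> borel_measurable M"
proof -
  have "(\<lambda>(\<omega>, x). (if dist (u \<omega>) x < D then 0 else 1) * marked_intensity x (h \<omega>)) \<in> borel_measurable (M \<Otimes>\<^sub>M lborel)"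
    by measurable
  then show ?thesis
    unfolding far_compensator_def indicator_Compl_ball by (rule lborel.borel_measurable_nn_integral)
qed

lemma marked_count_measurable [measurable]: "marked_count \<in> borel_measurable config_space"
  unfolding marked_count_def by (rule measurable_sum_points) measurable

lemma compensator_measurable [measurable]: "compensator \<in> borel_measurable config_space"
  unfolding compensator_def by measurable

lemma mark_le: "mark x \<gamma> \<le> indicator \<Lambda> x"
  by (auto simp: mark_def split: split_indicator)

lemma marked_intensity_le: "\<gamma> \<in> configs \<Longrightarrow> marked_intensity x \<gamma> \<le> ennreal z * indicator \<Lambda> x"
  using lam_le by (auto simp: marked_intensity_def mark_def split: split_indicator)

text \<open>Sums over the points evaluate the mark at \<open>x\<close> on \<open>\<gamma> - {x}\<close>, so locality is needed for the deletion
  of a second point.\<close>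

lemma mark_far: "\<gamma> \<in> configs \<Longrightarrow> dist x y \<ge> D \<Longrightarrow> mark x (\<gamma> - {y}) = mark x \<gamma>"
  using A_local[of "\<gamma> - {y}" x y] configs_Diff[of \<gamma> "{y}"]
  by (cases "y \<in> \<gamma>") (auto simp: mark_def insert_absorb split: split_indicator)

lemma marked_intensity_far: "\<gamma> \<in> configs \<Longrightarrow> dist x y \<ge> D \<Longrightarrow> marked_intensity x (\<gamma> - {y}) = marked_intensity x \<gamma>"
  using A_local[of "\<gamma> - {y}" x y] lam_local[of "\<gamma> - {y}" x y] configs_Diff[of \<gamma> "{y}"]
  by (cases "y \<in> \<gamma>") (auto simp: marked_intensity_def mark_def insert_absorb split: split_indicator)

lemma marked_count_le: "\<gamma> \<in> configs \<Longrightarrow> marked_count \<gamma> \<le> of_nat (N \<gamma>)"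
  unfolding marked_count_def emeasure_count_config[OF _ \<Lambda>_bounded, symmetric]
  by (intro nn_integral_mono mark_le)

lemma compensator_le: "\<gamma> \<in> configs \<Longrightarrow> compensator \<gamma> \<le> ennreal z * vol"
  unfolding compensator_def
  by (rule order_trans[OF nn_integral_mono[OF marked_intensity_le]]) (simp_all add: nn_integral_cmult_indicator)

lemma gnz_mark:
  assumes H: "case_prod H \<in> borel_measurable (borel \<Otimes>\<^sub>M config_space)"
  shows "(\<integral>\<^sup>+\<gamma>. (\<integral>\<^sup>+x. mark x (\<gamma> - {x}) * H x (\<gamma> - {x}) \<partial>count_space \<gamma>) \<partial>P) =
         (\<integral>\<^sup>+\<gamma>. (\<integral>\<^sup>+x. marked_intensity x \<gamma> * H x \<gamma> \<partial>lborel) \<partial>P)"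
proof -
  note [measurable (raw)] = measurable_case_prod_app[OF H]
  have "(\<integral>\<^sup>+\<gamma>. (\<integral>\<^sup>+x. mark x (\<gamma> - {x}) * H x (\<gamma> - {x}) \<partial>count_space \<gamma>) \<partial>P) =
         (\<integral>\<^sup>+\<gamma>. (\<integral>\<^sup>+x. (mark x \<gamma> * H x \<gamma>) * lam x \<gamma> \<partial>lborel) \<partial>P)"
    by (rule gnz) measurable
  then show ?thesis by (simp add: marked_intensity_def mult_ac)
qed

lemma mean_marked_count: "(\<integral>\<^sup>+\<gamma>. marked_count \<gamma> \<partial>P) = (\<integral>\<^sup>+\<gamma>. compensator \<gamma> \<partial>P)"
  using gnz_mark[of "\<lambda>_ _. 1"] by (simp add: marked_count_def compensator_def)

text \<open>Putting \<open>x\<close> back into the configuration raises \<open>N\<close> by one for almost every \<open>x\<close> in \<open>\<Lambda>\<close>. The extra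
  term is the covariance of \<open>N\<close> with the difference of \<open>marked_count\<close> and \<open>compensator\<close>.\<close>

lemma covariance_N_marked_count:
  "(\<integral>\<^sup>+\<gamma>. of_nat (N \<gamma>) * marked_count \<gamma> \<partial>P) = (\<integral>\<^sup>+\<gamma>. of_nat (N \<gamma>) * compensator \<gamma> \<partial>P) + (\<integral>\<^sup>+\<gamma>. compensator \<gamma> \<partial>P)"
proof -
  have [measurable]: "(\<lambda>\<gamma>. N \<gamma>) \<in> measurable config_space (count_space UNIV)"
    by (rule measurable_card_Int) (auto intro: \<Lambda>_bounded)
  have "(\<integral>\<^sup>+\<gamma>. of_nat (N \<gamma>) * marked_count \<gamma> \<partial>P) =
    (\<integral>\<^sup>+\<gamma>. (\<integral>\<^sup>+x. mark x (\<gamma> - {x}) * of_nat (N (insert x (\<gamma> - {x}))) \<partial>count_space \<gamma>) \<partial>P)"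
    by (intro nn_integral_cong, unfold marked_count_def, subst nn_integral_cmult[symmetric])
      (auto intro!: nn_integral_cong simp: insert_absorb mult.commute)
  also have "\<dots> = (\<integral>\<^sup>+\<gamma>. (\<integral>\<^sup>+x. marked_intensity x \<gamma> * of_nat (N (insert x \<gamma>)) \<partial>lborel) \<partial>P)"
    by (rule gnz_mark) measurable
  also have "\<dots> = (\<integral>\<^sup>+\<gamma>. of_nat (N \<gamma>) * compensator \<gamma> + compensator \<gamma> \<partial>P)"
  proof (rule nn_integral_cong)
    fix \<gamma> assume "\<gamma> \<in> space P"
    then have \<gamma>: "\<gamma> \<in> configs" by (simp add: space_P)
    have [measurable]: "\<gamma> \<in> space config_space" using \<gamma> by (simp add: space_config_space)
    have "AE x in lborel. x \<notin> \<gamma>"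
      using countable_imp_null_set_lborel[OF configs_countable[OF \<gamma>]] by (rule AE_not_in)
    then have "(\<integral>\<^sup>+x. marked_intensity x \<gamma> * of_nat (N (insert x \<gamma>)) \<partial>lborel) =
      (\<integral>\<^sup>+x. of_nat (N \<gamma>) * marked_intensity x \<gamma> + marked_intensity x \<gamma> \<partial>lborel)"
    proof (intro nn_integral_cong_AE, eventually_elim)
      fix x assume "x \<notin> \<gamma>"
      then have "N (insert x \<gamma>) = Suc (N \<gamma>)" if "x \<in> \<Lambda>"
        using that finite_config_Int[OF \<gamma> \<Lambda>_bounded] by (simp add: Int_insert_left)
      then show "marked_intensity x \<gamma> * of_nat (N (insert x \<gamma>)) = of_nat (N \<gamma>) * marked_intensity x \<gamma> + marked_intensity x \<gamma>"
        by (cases "x \<in> \<Lambda>") (auto simp: marked_intensity_def mark_def algebra_simps)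
    qed
    also have "\<dots> = of_nat (N \<gamma>) * compensator \<gamma> + compensator \<gamma>"
      by (simp add: nn_integral_add nn_integral_cmult compensator_def)
    finally show "(\<integral>\<^sup>+x. marked_intensity x \<gamma> * of_nat (N (insert x \<gamma>)) \<partial>lborel) = of_nat (N \<gamma>) * compensator \<gamma> + compensator \<gamma>" .
  qed
  also have "\<dots> = (\<integral>\<^sup>+\<gamma>. of_nat (N \<gamma>) * compensator \<gamma> \<partial>P) + (\<integral>\<^sup>+\<gamma>. compensator \<gamma> \<partial>P)"
    by (rule nn_integral_add) measurable
  finally show ?thesis .
qed

text \<open>For a marked location \<open>x\<close>, the factor counts \<open>x\<close> itself and the points closer to it than \<open>D\<close>. The
  bound \<open>z\<close> on the intensity controls both, so near pairs contribute in proportion to the volume.\<close>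

lemma mean_near:
  "(\<integral>\<^sup>+\<gamma>. (\<integral>\<^sup>+x. marked_intensity x \<gamma> * (1 + (\<integral>\<^sup>+y. indicator (ball x D) y \<partial>count_space \<gamma>)) \<partial>lborel) \<partial>P)
    \<le> ennreal z * vol * (1 + ennreal z * ennreal near_volume)"
proof -
  define n where "n x \<gamma> = (\<integral>\<^sup>+y. indicator (ball x D) y \<partial>count_space \<gamma>)" for x :: 'a and \<gamma>
  have [measurable]: "(\<lambda>p. n (snd p) (fst p)) \<in> borel_measurable (config_space \<Otimes>\<^sub>M borel)"
    unfolding n_def indicator_ball by (rule measurable_sum_points) measurable
  have "(\<integral>\<^sup>+\<gamma>. (\<integral>\<^sup>+x. marked_intensity x \<gamma> * (1 + n x \<gamma>) \<partial>lborel) \<partial>P)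
     \<le> (\<integral>\<^sup>+\<gamma>. (\<integral>\<^sup>+x. ennreal z * indicator \<Lambda> x * (1 + n x \<gamma>) \<partial>lborel) \<partial>P)"
    using marked_intensity_le by (intro nn_integral_mono mult_right_mono) (auto simp: space_P)
  also have "\<dots> = (\<integral>\<^sup>+x. (\<integral>\<^sup>+\<gamma>. ennreal z * indicator \<Lambda> x * (1 + n x \<gamma>) \<partial>P) \<partial>lborel)"
    by (rule Fubini'[symmetric]) measurable
  also have "\<dots> = (\<integral>\<^sup>+x. ennreal z * indicator \<Lambda> x * (1 + (\<integral>\<^sup>+\<gamma>. n x \<gamma> \<partial>P)) \<partial>lborel)"
  proof (rule nn_integral_cong)
    fix x :: 'a
    have [measurable]: "(\<lambda>\<gamma>. n x \<gamma>) \<in> borel_measurable config_space"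
      unfolding n_def indicator_ball by (rule measurable_sum_points) measurable
    show "(\<integral>\<^sup>+\<gamma>. ennreal z * indicator \<Lambda> x * (1 + n x \<gamma>) \<partial>P) = ennreal z * indicator \<Lambda> x * (1 + (\<integral>\<^sup>+\<gamma>. n x \<gamma> \<partial>P))"
      by (subst nn_integral_cmult, measurable, subst nn_integral_add, measurable) (simp add: emeasure_space_1)
  qed
  also have "\<dots> \<le> (\<integral>\<^sup>+x. ennreal z * indicator \<Lambda> x * (1 + ennreal z * ennreal near_volume) \<partial>lborel)"
    using intensity_le[of "ball _ D"] D_nonneg
    by (intro nn_integral_mono mult_left_mono add_left_mono) (auto simp: n_def emeasure_ball near_volume_def)
  also have "\<dots> = ennreal z * vol * (1 + ennreal z * ennreal near_volume)"
    by (simp add: nn_integral_multc nn_integral_cmult_indicator)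
  finally show ?thesis by (simp add: n_def)
qed

text \<open>Expand the square as a sum over pairs of points. Applying the Gibbs equation to the first point
  turns the near pairs, bounded by dropping the second mark, into \<open>mean_near\<close>. For a far pair neither
  point affects the mark of the other, so the equation applies again to the second point and yields
  \<open>far_pairs\<close>.\<close>

lemma second_moment_marked_count:
  "(\<integral>\<^sup>+\<gamma>. marked_count \<gamma> * marked_count \<gamma> \<partial>P)
    \<le> far_pairs + ennreal z * vol * (1 + ennreal z * ennreal near_volume)"
proof -
  define H1 where "H1 x \<gamma> = 1 + (\<integral>\<^sup>+y. indicator (ball x D) y \<partial>count_space \<gamma>)" for x :: 'a and \<gamma>
  define H2 where "H2 x \<gamma> = (\<integral>\<^sup>+y. indicator (- ball x D) y * mark y (\<gamma> - {y}) \<partial>count_space \<gamma>)" for x :: 'a and \<gamma>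
  have H1: "case_prod H1 \<in> borel_measurable (borel \<Otimes>\<^sub>M config_space)"
    unfolding H1_def indicator_ball case_prod_unfold
    by (intro borel_measurable_add measurable_sum_points) measurable
  have H2: "case_prod H2 \<in> borel_measurable (borel \<Otimes>\<^sub>M config_space)"
    unfolding H2_def indicator_Compl_ball case_prod_unfold
    by (intro measurable_sum_points) measurable
  note [measurable (raw)] = measurable_case_prod_app[OF H1] measurable_case_prod_app[OF H2]
  have S_le_H: "marked_count \<gamma> \<le> H1 x (\<gamma> - {x}) + H2 x (\<gamma> - {x})" if \<gamma>: "\<gamma> \<in> configs" and x: "x \<in> \<gamma>" for x \<gamma>
  proof -
    have "mark y (\<gamma> - {y}) \<le> indicator (ball x D) y + indicator (- ball x D) y * mark y (\<gamma> - {x} - {y})" for y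
    proof (cases "dist x y < D")
      case True
      then show ?thesis using mark_le[of y "\<gamma> - {y}"] by (auto split: split_indicator_asm)
    next
      case False
      then have "mark y (\<gamma> - {y} - {x}) = mark y (\<gamma> - {y})"
        by (intro mark_far configs_Diff \<gamma>) (simp add: dist_commute)
      moreover have "\<gamma> - {y} - {x} = \<gamma> - {x} - {y}" by auto
      ultimately show ?thesis using False by simp
    qed
    then have "(\<integral>\<^sup>+y. mark y (\<gamma> - {y}) \<partial>count_space (\<gamma> - {x})) \<le>
      (\<integral>\<^sup>+y. indicator (ball x D) y + indicator (- ball x D) y * mark y (\<gamma> - {x} - {y}) \<partial>count_space (\<gamma> - {x}))"
      by (intro nn_integral_mono)
    also have "\<dots> = (\<integral>\<^sup>+y. indicator (ball x D) y \<partial>count_space (\<gamma> - {x})) + H2 x (\<gamma> - {x})"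
      unfolding H2_def by (rule nn_integral_add) auto
    finally have "(\<integral>\<^sup>+y. mark y (\<gamma> - {y}) \<partial>count_space (\<gamma> - {x})) \<le> \<dots>" .
    moreover have "mark x (\<gamma> - {x}) \<le> 1" by (rule order_trans[OF mark_le]) (auto split: split_indicator)
    ultimately show ?thesis
      unfolding marked_count_def H1_def sum_points_remove[OF x] by (simp add: add.assoc add_mono)
  qed
  have "(\<integral>\<^sup>+\<gamma>. marked_count \<gamma> * marked_count \<gamma> \<partial>P) = (\<integral>\<^sup>+\<gamma>. (\<integral>\<^sup>+x. mark x (\<gamma> - {x}) * marked_count \<gamma> \<partial>count_space \<gamma>) \<partial>P)"
    by (intro nn_integral_cong, subst nn_integral_multc) (auto simp: marked_count_def)
  also have "\<dots> \<le> (\<integral>\<^sup>+\<gamma>. (\<integral>\<^sup>+x. mark x (\<gamma> - {x}) * (H1 x (\<gamma> - {x}) + H2 x (\<gamma> - {x})) \<partial>count_space \<gamma>) \<partial>P)"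
    by (intro nn_integral_mono mult_left_mono S_le_H) (auto simp: space_P)
  also have "\<dots> = (\<integral>\<^sup>+\<gamma>. (\<integral>\<^sup>+x. marked_intensity x \<gamma> * (H1 x \<gamma> + H2 x \<gamma>) \<partial>lborel) \<partial>P)"
    by (rule gnz_mark) measurable
  also have "\<dots> = (\<integral>\<^sup>+\<gamma>. (\<integral>\<^sup>+x. marked_intensity x \<gamma> * H1 x \<gamma> \<partial>lborel) \<partial>P) + (\<integral>\<^sup>+\<gamma>. (\<integral>\<^sup>+x. marked_intensity x \<gamma> * H2 x \<gamma> \<partial>lborel) \<partial>P)"
  proof -
    have "(\<integral>\<^sup>+x. marked_intensity x \<gamma> * (H1 x \<gamma> + H2 x \<gamma>) \<partial>lborel) =
        (\<integral>\<^sup>+x. marked_intensity x \<gamma> * H1 x \<gamma> \<partial>lborel) + (\<integral>\<^sup>+x. marked_intensity x \<gamma> * H2 x \<gamma> \<partial>lborel)" if "\<gamma> \<in> space P" for \<gamma>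
    proof -
      have [measurable]: "\<gamma> \<in> space config_space" using that by (simp add: space_P space_config_space)
      show ?thesis unfolding distrib_left by (rule nn_integral_add) measurable
    qed
    then have "(\<integral>\<^sup>+\<gamma>. (\<integral>\<^sup>+x. marked_intensity x \<gamma> * (H1 x \<gamma> + H2 x \<gamma>) \<partial>lborel) \<partial>P) =
       (\<integral>\<^sup>+\<gamma>. (\<integral>\<^sup>+x. marked_intensity x \<gamma> * H1 x \<gamma> \<partial>lborel) + (\<integral>\<^sup>+x. marked_intensity x \<gamma> * H2 x \<gamma> \<partial>lborel) \<partial>P)"
      by (rule nn_integral_cong)
    also have "\<dots> = (\<integral>\<^sup>+\<gamma>. (\<integral>\<^sup>+x. marked_intensity x \<gamma> * H1 x \<gamma> \<partial>lborel) \<partial>P) + (\<integral>\<^sup>+\<gamma>. (\<integral>\<^sup>+x. marked_intensity x \<gamma> * H2 x \<gamma> \<partial>lborel) \<partial>P)"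
      by (rule nn_integral_add) measurable
    finally show ?thesis .
  qed
  also have "(\<integral>\<^sup>+\<gamma>. (\<integral>\<^sup>+x. marked_intensity x \<gamma> * H2 x \<gamma> \<partial>lborel) \<partial>P) =
     (\<integral>\<^sup>+\<gamma>. (\<integral>\<^sup>+y. mark y (\<gamma> - {y}) * far_compensator y (\<gamma> - {y}) \<partial>count_space \<gamma>) \<partial>P)"
  proof (rule nn_integral_cong)
    fix \<gamma> assume "\<gamma> \<in> space P"
    then have \<gamma>: "\<gamma> \<in> configs" by (simp add: space_P)
    have [measurable]: "\<gamma> \<in> space config_space" using \<gamma> by (simp add: space_config_space)
    have "(\<integral>\<^sup>+x. marked_intensity x \<gamma> * H2 x \<gamma> \<partial>lborel) =
      (\<integral>\<^sup>+x. (\<integral>\<^sup>+y. marked_intensity x \<gamma> * (indicator (- ball x D) y * mark y (\<gamma> - {y})) \<partial>count_space \<gamma>) \<partial>lborel)"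
      by (simp add: H2_def nn_integral_cmult)
    also have "\<dots> = (\<integral>\<^sup>+y. (\<integral>\<^sup>+x. marked_intensity x \<gamma> * (indicator (- ball x D) y * mark y (\<gamma> - {y})) \<partial>lborel) \<partial>count_space \<gamma>)"
      unfolding indicator_Compl_ball
    proof (rule nn_integral_sum_points_swap[OF configs_countable[OF \<gamma>] lborel.sigma_finite_measure_axioms])
      fix y
      have "(\<lambda>x. marked_intensity x \<gamma> * ((if dist x y < D then 0 else 1) * c)) \<in> borel_measurable lborel" for c
        by measurable
      then show "(\<lambda>x. marked_intensity x \<gamma> * ((if dist x y < D then 0 else 1) * mark y (\<gamma> - {y}))) \<in> borel_measurable lborel" .
    qed
    also have "\<dots> = (\<integral>\<^sup>+y. mark y (\<gamma> - {y}) * far_compensator y (\<gamma> - {y}) \<partial>count_space \<gamma>)"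
    proof (rule nn_integral_cong)
      fix y assume "y \<in> space (count_space \<gamma>)"
      have [measurable]: "\<gamma> - {y} \<in> space config_space" using \<gamma> by (simp add: space_config_space configs_Diff)
      have "marked_intensity x \<gamma> * (indicator (- ball x D) y * mark y (\<gamma> - {y})) =
        mark y (\<gamma> - {y}) * (indicator (- ball y D) x * marked_intensity x (\<gamma> - {y}))" for x
        using marked_intensity_far[OF \<gamma>, of x y] by (auto simp: dist_commute mult.commute split: split_indicator)
      then show "(\<integral>\<^sup>+x. marked_intensity x \<gamma> * (indicator (- ball x D) y * mark y (\<gamma> - {y})) \<partial>lborel) =
        mark y (\<gamma> - {y}) * far_compensator y (\<gamma> - {y})"
        unfolding far_compensator_def by (simp add: nn_integral_cmult)
    qed
    finally show "(\<integral>\<^sup>+x. marked_intensity x \<gamma> * H2 x \<gamma> \<partial>lborel) =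
      (\<integral>\<^sup>+y. mark y (\<gamma> - {y}) * far_compensator y (\<gamma> - {y}) \<partial>count_space \<gamma>)" .
  qed
  also have "\<dots> = far_pairs"
    unfolding far_pairs_def by (rule gnz_mark) measurable
  also have "(\<integral>\<^sup>+\<gamma>. (\<integral>\<^sup>+x. marked_intensity x \<gamma> * H1 x \<gamma> \<partial>lborel) \<partial>P) + far_pairs
    \<le> ennreal z * vol * (1 + ennreal z * ennreal near_volume) + far_pairs"
    unfolding H1_def by (rule add_right_mono[OF mean_near])
  finally show ?thesis by (simp only: add.commute)
qed

text \<open>Only the far part of the compensator is kept, where deleting the marked point changes nothing.\<close>

lemma mixed_moment: "far_pairs \<le> (\<integral>\<^sup>+\<gamma>. marked_count \<gamma> * compensator \<gamma> \<partial>P)"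
proof -
  have "far_pairs = (\<integral>\<^sup>+\<gamma>. (\<integral>\<^sup>+y. mark y (\<gamma> - {y}) * far_compensator y (\<gamma> - {y}) \<partial>count_space \<gamma>) \<partial>P)"
    unfolding far_pairs_def by (rule gnz_mark[symmetric]) measurable
  also have "\<dots> \<le> (\<integral>\<^sup>+\<gamma>. (\<integral>\<^sup>+y. mark y (\<gamma> - {y}) * compensator \<gamma> \<partial>count_space \<gamma>) \<partial>P)"
  proof (intro nn_integral_mono mult_left_mono)
    fix \<gamma> y assume "\<gamma> \<in> space P"
    then have \<gamma>: "\<gamma> \<in> configs" by (simp add: space_P)
    show "far_compensator y (\<gamma> - {y}) \<le> compensator \<gamma>"
      unfolding far_compensator_def compensator_def using marked_intensity_far[OF \<gamma>]
      by (intro nn_integral_mono) (auto simp: dist_commute split: split_indicator)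
  qed simp
  also have "\<dots> = (\<integral>\<^sup>+\<gamma>. marked_count \<gamma> * compensator \<gamma> \<partial>P)"
    by (intro nn_integral_cong, subst nn_integral_multc) (auto simp: marked_count_def)
  finally show ?thesis .
qed

text \<open>In the double integral, the pairs closer than \<open>D\<close> contribute at most \<open>z\<^sup>2\<close> times \<open>near_volume\<close> per
  unit volume.\<close>

lemma second_moment_compensator:
  "(\<integral>\<^sup>+\<gamma>. compensator \<gamma> * compensator \<gamma> \<partial>P)
    \<le> far_pairs + ennreal z * vol * (ennreal z * ennreal near_volume)"
proof -
  have "(\<integral>\<^sup>+\<gamma>. compensator \<gamma> * compensator \<gamma> \<partial>P) \<le> (\<integral>\<^sup>+\<gamma>. (\<integral>\<^sup>+y. marked_intensity y \<gamma> * far_compensator y \<gamma> \<partial>lborel) + ennreal z * vol * (ennreal z * ennreal near_volume) \<partial>P)"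
  proof (rule nn_integral_mono)
    fix \<gamma> assume "\<gamma> \<in> space P"
    then have \<gamma>: "\<gamma> \<in> configs" by (simp add: space_P)
    have [measurable]: "\<gamma> \<in> space config_space" using \<gamma> by (simp add: space_config_space)
    have "compensator \<gamma> \<le> far_compensator y \<gamma> + ennreal z * ennreal near_volume" for y
    proof -
      have "compensator \<gamma> \<le> (\<integral>\<^sup>+x. indicator (- ball y D) x * marked_intensity x \<gamma> + ennreal z * indicator (ball y D) x \<partial>lborel)"
        unfolding compensator_def using order_trans[OF marked_intensity_le[OF \<gamma>], of _ "ennreal z"] mult_left_mono[of "indicator \<Lambda> _" 1 "ennreal z"]
        by (intro nn_integral_mono) (auto split: split_indicator)
      also have "\<dots> = far_compensator y \<gamma> + (\<integral>\<^sup>+x. ennreal z * indicator (ball y D) x \<partial>lborel)"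
        unfolding far_compensator_def indicator_ball indicator_Compl_ball by (rule nn_integral_add) measurable
      also have "(\<integral>\<^sup>+x. ennreal z * indicator (ball y D) x \<partial>lborel) = ennreal z * ennreal near_volume"
        using D_nonneg by (simp add: nn_integral_cmult_indicator emeasure_ball near_volume_def)
      finally show ?thesis .
    qed
    then have "(\<integral>\<^sup>+y. marked_intensity y \<gamma> * compensator \<gamma> \<partial>lborel) \<le> (\<integral>\<^sup>+y. marked_intensity y \<gamma> * (far_compensator y \<gamma> + ennreal z * ennreal near_volume) \<partial>lborel)"
      by (intro nn_integral_mono mult_left_mono) auto
    also have "(\<integral>\<^sup>+y. marked_intensity y \<gamma> * compensator \<gamma> \<partial>lborel) = compensator \<gamma> * compensator \<gamma>"
      by (subst nn_integral_multc) (simp_all add: compensator_def)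
    also have "(\<integral>\<^sup>+y. marked_intensity y \<gamma> * (far_compensator y \<gamma> + ennreal z * ennreal near_volume) \<partial>lborel) =
      (\<integral>\<^sup>+y. marked_intensity y \<gamma> * far_compensator y \<gamma> \<partial>lborel) + (\<integral>\<^sup>+y. marked_intensity y \<gamma> * (ennreal z * ennreal near_volume) \<partial>lborel)"
      unfolding distrib_left by (rule nn_integral_add) measurable
    also have "(\<integral>\<^sup>+y. marked_intensity y \<gamma> * (ennreal z * ennreal near_volume) \<partial>lborel) = compensator \<gamma> * (ennreal z * ennreal near_volume)"
      unfolding compensator_def by (rule nn_integral_multc) measurable
    finally show "compensator \<gamma> * compensator \<gamma> \<le> (\<integral>\<^sup>+y. marked_intensity y \<gamma> * far_compensator y \<gamma> \<partial>lborel) + ennreal z * vol * (ennreal z * ennreal near_volume)"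
      using mult_right_mono[OF compensator_le[OF \<gamma>], of "ennreal z * ennreal near_volume"] by (auto intro: order_trans add_left_mono)
  qed
  also have "\<dots> = far_pairs + ennreal z * vol * (ennreal z * ennreal near_volume)"
    unfolding far_pairs_def by (subst nn_integral_add) (simp_all add: emeasure_space_1)
  finally show ?thesis .
qed

text \<open>All points have density \<open>\<rho>\<close>. By the Gibbs equation the unmarked ones have density at most \<open>z\<close> times
  the bound \<open>\<epsilon>\<close> on the probability that \<open>A\<close> fails, which leaves \<open>\<rho> - z * \<epsilon>\<close> for the marked ones.\<close>

lemma mean_compensator_lower_bound:
  assumes rare: "\<And>x. emeasure P {\<gamma> \<in> configs. (x, \<gamma>) \<notin> A} \<le> ennreal \<epsilon>"
    and density: "(\<integral>\<^sup>+\<gamma>. (\<integral>\<^sup>+x. indicator \<Lambda> x \<partial>count_space \<gamma>) \<partial>P) = ennreal \<rho> * vol"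
    and \<epsilon>: "\<epsilon> \<ge> 0" "z * \<epsilon> \<le> \<rho>"
  shows "ennreal ((\<rho> - z * \<epsilon>) * measure lborel \<Lambda>) \<le> (\<integral>\<^sup>+\<gamma>. compensator \<gamma> \<partial>P)"
proof -
  define L where "L = measure lborel \<Lambda>"
  have L: "L \<ge> 0" by (simp add: L_def)
  have vol: "vol = ennreal L"
    using emeasure_bounded_finite[OF \<Lambda>_bounded] by (simp add: L_def emeasure_eq_ennreal_measure)
  define f' where "f' x \<gamma> = indicator \<Lambda> x * (indicator (- A) (x, \<gamma>) :: ennreal)" for x \<gamma>
  have f'_eq: "f' x \<gamma> = indicator \<Lambda> x * (if (x, \<gamma>) \<in> A then 0 else 1 :: ennreal)" for x \<gamma>
    by (auto simp: f'_def split: split_indicator)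
  have [measurable]: "Measurable.pred (borel \<Otimes>\<^sub>M config_space) (\<lambda>p. p \<in> A)"
    by (rule pred_sets2[OF A_sets]) simp
  have f'_meas: "case_prod f' \<in> borel_measurable (borel \<Otimes>\<^sub>M config_space)"
    unfolding f'_eq by measurable
  note [measurable (raw)] = measurable_case_prod_app[OF f'_meas]
  have "ennreal \<rho> * vol = (\<integral>\<^sup>+\<gamma>. marked_count \<gamma> + (\<integral>\<^sup>+x. f' x (\<gamma> - {x}) \<partial>count_space \<gamma>) \<partial>P)"
    unfolding density[symmetric] marked_count_def
    by (intro nn_integral_cong, subst nn_integral_add[symmetric])
      (auto intro!: nn_integral_cong simp: mark_def f'_def split: split_indicator)
  also have "\<dots> = (\<integral>\<^sup>+\<gamma>. marked_count \<gamma> \<partial>P) + (\<integral>\<^sup>+\<gamma>. (\<integral>\<^sup>+x. f' x (\<gamma> - {x}) \<partial>count_space \<gamma>) \<partial>P)"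
  proof (rule nn_integral_add)
    show "(\<lambda>\<gamma>. \<integral>\<^sup>+x. f' x (\<gamma> - {x}) \<partial>count_space \<gamma>) \<in> borel_measurable P"
      by (rule measurable_sum_points[OF measurable_ident_P]) measurable
  qed simp
  also have "(\<integral>\<^sup>+\<gamma>. (\<integral>\<^sup>+x. f' x (\<gamma> - {x}) \<partial>count_space \<gamma>) \<partial>P) = (\<integral>\<^sup>+\<gamma>. (\<integral>\<^sup>+x. f' x \<gamma> * lam x \<gamma> \<partial>lborel) \<partial>P)"
    by (rule gnz[OF f'_meas])
  also have "\<dots> \<le> (\<integral>\<^sup>+\<gamma>. (\<integral>\<^sup>+x. f' x \<gamma> * ennreal z \<partial>lborel) \<partial>P)"
    by (intro nn_integral_mono mult_left_mono lam_le) (auto simp: space_P)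
  also have "\<dots> = (\<integral>\<^sup>+x. (\<integral>\<^sup>+\<gamma>. f' x \<gamma> * ennreal z \<partial>P) \<partial>lborel)"
    by (rule Fubini'[symmetric]) measurable
  also have "\<dots> \<le> (\<integral>\<^sup>+x. indicator \<Lambda> x * (ennreal \<epsilon> * ennreal z) \<partial>lborel)"
  proof (rule nn_integral_mono)
    fix x :: 'a
    have "(\<lambda>\<gamma>. f' x \<gamma>) \<in> borel_measurable P" by measurable
    then have "(\<integral>\<^sup>+\<gamma>. f' x \<gamma> * ennreal z \<partial>P) = (\<integral>\<^sup>+\<gamma>. f' x \<gamma> \<partial>P) * ennreal z"
      by (rule nn_integral_multc)
    also have "(\<integral>\<^sup>+\<gamma>. f' x \<gamma> \<partial>P) = (\<integral>\<^sup>+\<gamma>. indicator \<Lambda> x * indicator {\<gamma> \<in> configs. (x, \<gamma>) \<notin> A} \<gamma> \<partial>P)"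
      by (intro nn_integral_cong) (auto simp: f'_def space_P split: split_indicator)
    also have "\<dots> = indicator \<Lambda> x * emeasure P {\<gamma> \<in> configs. (x, \<gamma>) \<notin> A}"
    proof (rule nn_integral_cmult_indicator)
      have "{\<gamma> \<in> space config_space. (x, \<gamma>) \<notin> A} \<in> sets config_space" by measurable
      then show "{\<gamma> \<in> configs. (x, \<gamma>) \<notin> A} \<in> events" by (simp add: sets_P space_config_space)
    qed
    also have "\<dots> * ennreal z \<le> indicator \<Lambda> x * (ennreal \<epsilon> * ennreal z)"
      using rare[of x] by (simp add: mult.assoc mult_left_mono mult_right_mono)
    finally show "(\<integral>\<^sup>+\<gamma>. f' x \<gamma> * ennreal z \<partial>P) \<le> indicator \<Lambda> x * (ennreal \<epsilon> * ennreal z)" .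
  qed
  also have "\<dots> = ennreal (z * \<epsilon> * L)"
    using \<epsilon> z_pos L by (simp add: nn_integral_multc vol ennreal_mult[symmetric] mult_ac)
  finally have "ennreal (\<rho> * L) \<le> (\<integral>\<^sup>+\<gamma>. marked_count \<gamma> \<partial>P) + ennreal (z * \<epsilon> * L)"
    using L by (simp add: vol ennreal_mult'' add_left_mono)
  then have "ennreal (\<rho> * L) - ennreal (z * \<epsilon> * L) \<le> (\<integral>\<^sup>+\<gamma>. compensator \<gamma> \<partial>P)"
    unfolding mean_marked_count by (simp add: ennreal_minus_le_iff add.commute)
  moreover have "ennreal (\<rho> * L) - ennreal (z * \<epsilon> * L) = ennreal ((\<rho> - z * \<epsilon>) * L)"
    using \<epsilon> z_pos L by (subst ennreal_minus) (auto simp: left_diff_distrib)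
  ultimately show ?thesis by (simp add: L_def)
qed

lemma near_volume_nonneg: "near_volume \<ge> 0"
  unfolding near_volume_def using D_nonneg by (simp add: unit_ball_vol_nonneg)

text \<open>Let \<open>X\<close> be \<open>marked_count\<close> minus \<open>compensator\<close>. The far pairs cancel in the expectation of \<open>X\<^sup>2\<close>, which
  is therefore at most proportional to the volume, while the covariance of \<open>X\<close> with \<open>N\<close> is at least
  proportional to it. By the Cauchy-Schwarz inequality the variance of \<open>N\<close> grows at least like the
  volume.\<close>

lemma variance_lower_bound:
  assumes square_integrable: "integrable P (\<lambda>\<gamma>. (real (N \<gamma>))\<^sup>2)"
    and c: "c > 0" and mass: "ennreal (c * measure lborel \<Lambda>) \<le> (\<integral>\<^sup>+\<gamma>. compensator \<gamma> \<partial>P)"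
  shows "c\<^sup>2 * measure lborel \<Lambda> \<le> (z + 2 * z\<^sup>2 * near_volume) * variance (\<lambda>\<gamma>. real (N \<gamma>))"
proof -
  define L where "L = measure lborel \<Lambda>"
  have L: "L \<ge> 0" by (simp add: L_def)
  have vol: "vol = ennreal L"
    using emeasure_bounded_finite[OF \<Lambda>_bounded] by (simp add: L_def emeasure_eq_ennreal_measure)
  define n where "n \<gamma> = real (N \<gamma>)" for \<gamma>
  define s where "s \<gamma> = enn2real (marked_count \<gamma>)" for \<gamma>
  define i where "i \<gamma> = enn2real (compensator \<gamma>)" for \<gamma>
  have [measurable]: "(\<lambda>\<gamma>. N \<gamma>) \<in> measurable config_space (count_space UNIV)"
    by (rule measurable_card_Int) (auto intro: \<Lambda>_bounded)
  have n_meas [measurable]: "n \<in> borel_measurable config_space" unfolding n_def by measurable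
  have s_meas [measurable]: "s \<in> borel_measurable config_space" unfolding s_def by measurable
  have i_meas [measurable]: "i \<in> borel_measurable config_space" unfolding i_def by measurable
  have S_real: "marked_count \<gamma> = ennreal (s \<gamma>)" if "\<gamma> \<in> configs" for \<gamma>
    using marked_count_le[OF that] unfolding s_def
    by (metis ennreal_enn2real infinity_ennreal_def less_top of_nat_less_top order_le_less_trans)
  have I_real: "compensator \<gamma> = ennreal (i \<gamma>)" if "\<gamma> \<in> configs" for \<gamma>
    using compensator_le[OF that] unfolding i_def vol
    by (metis ennreal_enn2real ennreal_less_top ennreal_mult_less_top order_le_less_trans)
  have n0: "n \<gamma> \<ge> 0" and s0: "s \<gamma> \<ge> 0" and i0: "i \<gamma> \<ge> 0" for \<gamma>
    by (auto simp: n_def s_def i_def)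
  have s_le: "s \<gamma> \<le> n \<gamma>" if "\<gamma> \<in> configs" for \<gamma>
    using marked_count_le[OF that] unfolding S_real[OF that] n_def by (simp add: ennreal_of_nat_eq_real_of_nat)
  have i_le: "i \<gamma> \<le> z * L" if "\<gamma> \<in> configs" for \<gamma>
    using compensator_le[OF that] z_pos L unfolding I_real[OF that] vol by (simp add: ennreal_mult[symmetric])
  \<comment> \<open>This dominating function serves for all products of \<open>n\<close>, \<open>s\<close> and \<open>i\<close>.\<close>
  have int: "integrable P u" if u: "u \<in> borel_measurable config_space"
    and le: "\<And>\<gamma>. \<gamma> \<in> configs \<Longrightarrow> \<bar>u \<gamma>\<bar> \<le> (n \<gamma>)\<^sup>2 + (z * L)\<^sup>2 + 1" for u :: "'a set \<Rightarrow> real"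
  proof (rule Bochner_Integration.integrable_bound)
    show "integrable P (\<lambda>\<gamma>. (n \<gamma>)\<^sup>2 + (z * L)\<^sup>2 + 1)"
      using square_integrable by (simp add: n_def)
    show "u \<in> borel_measurable P" using u by simp
    show "AE \<gamma> in P. norm (u \<gamma>) \<le> norm ((n \<gamma>)\<^sup>2 + (z * L)\<^sup>2 + 1)"
      using le by (auto simp: space_P)
  qed
  have prod_le: "\<bar>u * v\<bar> \<le> U\<^sup>2 + V\<^sup>2" if "\<bar>u\<bar> \<le> U" "\<bar>v\<bar> \<le> V" for u v U V :: real
  proof -
    have "\<bar>u * v\<bar> \<le> U * V" unfolding abs_mult using that by (intro mult_mono) auto
    moreover have "0 \<le> U * V" using that by (intro mult_nonneg_nonneg) linarith+
    ultimately show ?thesis using sum_squares_bound[of U V] by linarith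
  qed
  have sq_le: "\<bar>u * v\<bar> \<le> U\<^sup>2" if "\<bar>u\<bar> \<le> U" "\<bar>v\<bar> \<le> U" for u v U :: real
    unfolding abs_mult power2_eq_square using that by (intro mult_mono) auto
  have self_le: "\<bar>u\<bar> \<le> U\<^sup>2 + 1" if "\<bar>u\<bar> \<le> U" for u U :: real
    using prod_le[OF that, of 1 1] by simp
  have int_n: "integrable P n"
  proof (rule int)
    fix \<gamma> :: "'a set" assume "\<gamma> \<in> configs"
    then show "\<bar>n \<gamma>\<bar> \<le> (n \<gamma>)\<^sup>2 + (z * L)\<^sup>2 + 1"
      using self_le[of "n \<gamma>" "n \<gamma>"] n0[of \<gamma>] zero_le_power2[of "z * L"] by linarith
  qed simp
  have int_s: "integrable P s"
  proof (rule int)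
    fix \<gamma> :: "'a set" assume "\<gamma> \<in> configs"
    then show "\<bar>s \<gamma>\<bar> \<le> (n \<gamma>)\<^sup>2 + (z * L)\<^sup>2 + 1"
      using self_le[of "s \<gamma>" "n \<gamma>"] s0[of \<gamma>] s_le[of \<gamma>] zero_le_power2[of "z * L"] by linarith
  qed simp
  have int_i: "integrable P i"
  proof (rule int)
    fix \<gamma> :: "'a set" assume "\<gamma> \<in> configs"
    then show "\<bar>i \<gamma>\<bar> \<le> (n \<gamma>)\<^sup>2 + (z * L)\<^sup>2 + 1"
      using self_le[of "i \<gamma>" "z * L"] i0[of \<gamma>] i_le[of \<gamma>] zero_le_power2[of "n \<gamma>"] by linarith
  qed simp
  have int_nn: "integrable P (\<lambda>\<gamma>. n \<gamma> * n \<gamma>)"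
    using square_integrable by (simp add: n_def power2_eq_square)
  have int_ns: "integrable P (\<lambda>\<gamma>. n \<gamma> * s \<gamma>)"
  proof (rule int)
    fix \<gamma> :: "'a set" assume "\<gamma> \<in> configs"
    then show "\<bar>n \<gamma> * s \<gamma>\<bar> \<le> (n \<gamma>)\<^sup>2 + (z * L)\<^sup>2 + 1"
      using sq_le[of "n \<gamma>" "n \<gamma>" "s \<gamma>"] n0[of \<gamma>] s0[of \<gamma>] s_le[of \<gamma>] zero_le_power2[of "z * L"] by linarith
  qed measurable
  have int_ni: "integrable P (\<lambda>\<gamma>. n \<gamma> * i \<gamma>)"
  proof (rule int)
    fix \<gamma> :: "'a set" assume "\<gamma> \<in> configs"
    then show "\<bar>n \<gamma> * i \<gamma>\<bar> \<le> (n \<gamma>)\<^sup>2 + (z * L)\<^sup>2 + 1"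
      using prod_le[of "n \<gamma>" "n \<gamma>" "i \<gamma>" "z * L"] n0[of \<gamma>] i0[of \<gamma>] i_le[of \<gamma>] by linarith
  qed measurable
  have int_ss: "integrable P (\<lambda>\<gamma>. s \<gamma> * s \<gamma>)"
  proof (rule int)
    fix \<gamma> :: "'a set" assume "\<gamma> \<in> configs"
    then show "\<bar>s \<gamma> * s \<gamma>\<bar> \<le> (n \<gamma>)\<^sup>2 + (z * L)\<^sup>2 + 1"
      using sq_le[of "s \<gamma>" "n \<gamma>" "s \<gamma>"] s0[of \<gamma>] s_le[of \<gamma>] zero_le_power2[of "z * L"] by linarith
  qed measurable
  have int_si: "integrable P (\<lambda>\<gamma>. s \<gamma> * i \<gamma>)"
  proof (rule int)
    fix \<gamma> :: "'a set" assume "\<gamma> \<in> configs"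
    then show "\<bar>s \<gamma> * i \<gamma>\<bar> \<le> (n \<gamma>)\<^sup>2 + (z * L)\<^sup>2 + 1"
      using prod_le[of "s \<gamma>" "n \<gamma>" "i \<gamma>" "z * L"] s0[of \<gamma>] s_le[of \<gamma>] i0[of \<gamma>] i_le[of \<gamma>] by linarith
  qed measurable
  have int_ii: "integrable P (\<lambda>\<gamma>. i \<gamma> * i \<gamma>)"
  proof (rule int)
    fix \<gamma> :: "'a set" assume "\<gamma> \<in> configs"
    then show "\<bar>i \<gamma> * i \<gamma>\<bar> \<le> (n \<gamma>)\<^sup>2 + (z * L)\<^sup>2 + 1"
      using sq_le[of "i \<gamma>" "z * L" "i \<gamma>"] i0[of \<gamma>] i_le[of \<gamma>] zero_le_power2[of "n \<gamma>"] by linarith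
  qed measurable
  have to_real: "(\<integral>\<^sup>+\<gamma>. U \<gamma> \<partial>P) = ennreal (expectation u)" "expectation u \<ge> 0"
    if "integrable P u" "\<And>\<gamma>. \<gamma> \<in> configs \<Longrightarrow> U \<gamma> = ennreal (u \<gamma>)" "\<And>\<gamma>. u \<gamma> \<ge> 0" for u U
  proof -
    have "(\<integral>\<^sup>+\<gamma>. U \<gamma> \<partial>P) = (\<integral>\<^sup>+\<gamma>. ennreal (u \<gamma>) \<partial>P)"
      using that(2) by (intro nn_integral_cong) (simp add: space_P)
    also have "\<dots> = ennreal (expectation u)"
      using that(1,3) by (intro nn_integral_eq_integral) auto
    finally show "(\<integral>\<^sup>+\<gamma>. U \<gamma> \<partial>P) = ennreal (expectation u)" .
    show "expectation u \<ge> 0" using that(3) by simp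
  qed
  have eI: "(\<integral>\<^sup>+\<gamma>. compensator \<gamma> \<partial>P) = ennreal (expectation i)" "expectation i \<ge> 0"
    by (rule to_real[OF int_i]; simp add: I_real i0)+
  have eS: "(\<integral>\<^sup>+\<gamma>. marked_count \<gamma> \<partial>P) = ennreal (expectation s)" "expectation s \<ge> 0"
    by (rule to_real[OF int_s]; simp add: S_real s0)+
  have eSS: "(\<integral>\<^sup>+\<gamma>. marked_count \<gamma> * marked_count \<gamma> \<partial>P) = ennreal (expectation (\<lambda>\<gamma>. s \<gamma> * s \<gamma>))"
    by (rule to_real[OF int_ss]) (simp_all add: S_real s0 ennreal_mult)
  have eSI: "(\<integral>\<^sup>+\<gamma>. marked_count \<gamma> * compensator \<gamma> \<partial>P) = ennreal (expectation (\<lambda>\<gamma>. s \<gamma> * i \<gamma>))" "expectation (\<lambda>\<gamma>. s \<gamma> * i \<gamma>) \<ge> 0"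
    by (rule to_real[OF int_si]; simp add: S_real I_real s0 i0 ennreal_mult)+
  have eII: "(\<integral>\<^sup>+\<gamma>. compensator \<gamma> * compensator \<gamma> \<partial>P) = ennreal (expectation (\<lambda>\<gamma>. i \<gamma> * i \<gamma>))"
    by (rule to_real[OF int_ii]) (simp_all add: I_real i0 ennreal_mult)
  have eNS: "(\<integral>\<^sup>+\<gamma>. of_nat (N \<gamma>) * marked_count \<gamma> \<partial>P) = ennreal (expectation (\<lambda>\<gamma>. n \<gamma> * s \<gamma>))"
    by (rule to_real[OF int_ns]) (simp_all add: S_real s0 n0 ennreal_mult, simp add: n_def ennreal_of_nat_eq_real_of_nat)
  have eNI: "(\<integral>\<^sup>+\<gamma>. of_nat (N \<gamma>) * compensator \<gamma> \<partial>P) = ennreal (expectation (\<lambda>\<gamma>. n \<gamma> * i \<gamma>))" "expectation (\<lambda>\<gamma>. n \<gamma> * i \<gamma>) \<ge> 0"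
    by (rule to_real[OF int_ni]; simp add: I_real i0 n0 ennreal_mult; simp add: n_def ennreal_of_nat_eq_real_of_nat)+
  have m_ge: "c * L \<le> expectation i"
    using mass unfolding eI(1) L_def[symmetric] by (simp add: eI(2))
  have mean_eq: "expectation s = expectation i"
    using mean_marked_count unfolding eS(1) eI(1) by (simp add: eS(2) eI(2))
  have cov_eq: "expectation (\<lambda>\<gamma>. n \<gamma> * s \<gamma>) = expectation (\<lambda>\<gamma>. n \<gamma> * i \<gamma>) + expectation i"
    using covariance_N_marked_count unfolding eNS eNI(1) eI(1) using eNI(2) eI(2) n0 s0
    by (simp add: ennreal_plus[symmetric] del: ennreal_plus)
  define t where "t = enn2real far_pairs"
  have "far_pairs < top" using mixed_moment unfolding eSI(1) by (rule order_le_less_trans) simp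
  then have far_pairs: "far_pairs = ennreal t" "t \<ge> 0" by (simp_all add: t_def)
  have SS: "expectation (\<lambda>\<gamma>. s \<gamma> * s \<gamma>) \<le> t + z * L * (1 + z * near_volume)"
    using second_moment_marked_count z_pos L near_volume_nonneg far_pairs(2) unfolding eSS far_pairs(1) vol ennreal_1[symmetric]
    by (simp add: ennreal_mult[symmetric] ennreal_plus[symmetric] del: ennreal_plus ennreal_1)
  have II: "expectation (\<lambda>\<gamma>. i \<gamma> * i \<gamma>) \<le> t + z * L * (z * near_volume)"
    using second_moment_compensator z_pos L near_volume_nonneg far_pairs(2) unfolding eII far_pairs(1) vol
    by (simp add: ennreal_mult[symmetric] ennreal_plus[symmetric] del: ennreal_plus)
  have SI: "t \<le> expectation (\<lambda>\<gamma>. s \<gamma> * i \<gamma>)"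
    using mixed_moment eSI(2) unfolding eSI(1) far_pairs(1) by simp
  define X where "X \<gamma> = s \<gamma> - i \<gamma>" for \<gamma>
  define C where "C = z + 2 * z\<^sup>2 * near_volume"
  have C: "C > 0" using z_pos near_volume_nonneg by (auto simp: C_def intro: add_pos_nonneg)
  \<comment> \<open>The term \<open>t\<close> enters the three moments with total coefficient \<open>1 + 1 - 2 = 0\<close>.\<close>
  have XX: "expectation (\<lambda>\<gamma>. (X \<gamma>)\<^sup>2) \<le> C * L" and int_XX: "integrable P (\<lambda>\<gamma>. (X \<gamma>)\<^sup>2)"
  proof -
    have X2: "(\<lambda>\<gamma>. (X \<gamma>)\<^sup>2) = (\<lambda>\<gamma>. s \<gamma> * s \<gamma> + i \<gamma> * i \<gamma> - 2 * (s \<gamma> * i \<gamma>))"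
      by (auto simp: X_def power2_eq_square algebra_simps)
    show "integrable P (\<lambda>\<gamma>. (X \<gamma>)\<^sup>2)" unfolding X2 using int_ss int_si int_ii by simp
    have "expectation (\<lambda>\<gamma>. (X \<gamma>)\<^sup>2) = expectation (\<lambda>\<gamma>. s \<gamma> * s \<gamma>) + expectation (\<lambda>\<gamma>. i \<gamma> * i \<gamma>) - 2 * expectation (\<lambda>\<gamma>. s \<gamma> * i \<gamma>)"
      unfolding X2 using int_ss int_si int_ii by simp
    also have "\<dots> \<le> z * L * (1 + z * near_volume) + z * L * (z * near_volume)" using SS II SI by linarith
    also have "\<dots> = C * L" by (simp add: C_def power2_eq_square algebra_simps)
    finally show "expectation (\<lambda>\<gamma>. (X \<gamma>)\<^sup>2) \<le> C * L" .
  qed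
  define \<mu> where "\<mu> = expectation n"
  define V where "V = expectation (\<lambda>\<gamma>. (n \<gamma> - \<mu>)\<^sup>2)"
  have int_V: "integrable P (\<lambda>\<gamma>. (n \<gamma> - \<mu>)\<^sup>2)"
    using int_nn int_n by (simp add: power2_eq_square algebra_simps)
  have nX: "(n \<gamma> - \<mu>) * X \<gamma> = n \<gamma> * s \<gamma> - n \<gamma> * i \<gamma> - \<mu> * s \<gamma> + \<mu> * i \<gamma>" for \<gamma>
    by (simp add: X_def algebra_simps)
  have int_nX: "integrable P (\<lambda>\<gamma>. (n \<gamma> - \<mu>) * X \<gamma>)"
    unfolding nX using int_ns int_ni int_s int_i by simp
  have cov: "expectation (\<lambda>\<gamma>. (n \<gamma> - \<mu>) * X \<gamma>) = expectation i"
    unfolding nX using int_ns int_ni int_s int_i cov_eq mean_eq by simp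
  \<comment> \<open>The Cauchy-Schwarz inequality in its quadratic form, which needs no square roots.\<close>
  have quad: "2 * r * expectation i \<le> r\<^sup>2 * V + C * L" for r
  proof -
    have "2 * r * expectation i = expectation (\<lambda>\<gamma>. 2 * r * ((n \<gamma> - \<mu>) * X \<gamma>))"
      by (simp add: cov)
    also have "\<dots> \<le> expectation (\<lambda>\<gamma>. r\<^sup>2 * (n \<gamma> - \<mu>)\<^sup>2 + (X \<gamma>)\<^sup>2)"
    proof (rule integral_mono)
      show "2 * r * ((n \<gamma> - \<mu>) * X \<gamma>) \<le> r\<^sup>2 * (n \<gamma> - \<mu>)\<^sup>2 + (X \<gamma>)\<^sup>2" for \<gamma>
        using sum_squares_bound[of "r * (n \<gamma> - \<mu>)" "X \<gamma>"] by (simp add: power_mult_distrib mult_ac)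
    qed (use int_nX int_V int_XX in auto)
    also have "\<dots> = r\<^sup>2 * V + expectation (\<lambda>\<gamma>. (X \<gamma>)\<^sup>2)"
      using int_V int_XX by (simp add: V_def)
    finally show ?thesis using XX by linarith
  qed
  \<comment> \<open>For \<open>r = C / c\<close> the left-hand side is at least twice the term \<open>C * L\<close> on the right.\<close>
  have "2 * (C / c) * (c * L) \<le> 2 * (C / c) * expectation i"
    using m_ge C c by (intro mult_left_mono) auto
  with quad[of "C / c"] have "2 * (C * L) \<le> (C / c)\<^sup>2 * V + C * L" using c by simp
  then have "C * L \<le> C\<^sup>2 * V / c\<^sup>2" by (simp add: power_divide)
  then have "c\<^sup>2 * (C * L) \<le> C\<^sup>2 * V" using c by (simp add: pos_le_divide_eq mult.commute)
  then have "C * (c\<^sup>2 * L) \<le> C * (C * V)" by (simp add: power2_eq_square mult_ac)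
  then have "c\<^sup>2 * L \<le> C * V" using C by simp
  then show ?thesis by (simp add: L_def C_def V_def \<mu>_def n_def[abs_def])
qed

end

section \<open>Nearest neighbours\<close>

lemma lex_less_irrefl: "\<not> lex_less u u"
  by (simp add: lex_less_def)

lemma lex_less_trans: "lex_less u v \<Longrightarrow> lex_less v w \<Longrightarrow> lex_less u w"
  unfolding lex_less_def by (metis (no_types, lifting) less_trans linorder_neqE)

lemma lex_less_total:
  fixes u v :: "real ^ 'n::{finite,linorder}"
  assumes "u \<noteq> v" shows "lex_less u v \<or> lex_less v u"
proof -
  define i where "i = Min {i. u $ i \<noteq> v $ i}"
  have ne: "{i. u $ i \<noteq> v $ i} \<noteq> {}" using assms by (auto simp: vec_eq_iff)
  have "u $ i \<noteq> v $ i" using Min_in[OF _ ne] by (simp add: i_def)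
  moreover have "u $ j = v $ j" if "j < i" for j
  proof (rule ccontr)
    assume "u $ j \<noteq> v $ j"
    then have "i \<le> j" unfolding i_def by (intro Min_le) auto
    then show False using that by simp
  qed
  ultimately show ?thesis unfolding lex_less_def by (metis linorder_neqE)
qed

lemma nearer_irrefl: "\<not> nearer x u u"
  by (simp add: nearer_def lex_less_irrefl)

lemma nearer_trans: "nearer x u v \<Longrightarrow> nearer x v w \<Longrightarrow> nearer x u w"
  unfolding nearer_def using lex_less_trans[of u v w] by auto

lemma nearer_total: "u \<noteq> v \<Longrightarrow> nearer x u v \<or> nearer x v u"
  unfolding nearer_def using lex_less_total[of u v] by auto

lemma nearer_dist: "nearer x u v \<Longrightarrow> dist x u \<le> dist x v"
  by (auto simp: nearer_def)

text \<open>Ranks count from zero: the \<open>i\<close>-th neighbour is the point of rank \<open>i - 1\<close>. The function is also used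
  for points \<open>y\<close> outside \<open>\<gamma>\<close>, where it is the rank that \<open>y\<close> would get if it were added.\<close>

definition neighbour_rank :: "real ^ 'n::{finite,linorder} \<Rightarrow> (real ^ 'n::{finite,linorder}) set \<Rightarrow> real ^ 'n::{finite,linorder} \<Rightarrow> nat"
  where "neighbour_rank x \<gamma> y = card {u \<in> \<gamma> - {x}. nearer x u y}"

lemma finite_nearer:
  assumes "\<gamma> \<in> configs" shows "finite {u \<in> \<gamma> - {x}. nearer x u y}"
proof (rule finite_subset)
  show "{u \<in> \<gamma> - {x}. nearer x u y} \<subseteq> \<gamma> \<inter> cball x (dist x y)"
    using nearer_dist by auto
qed (rule finite_config_Int[OF assms bounded_cball])

lemma rank_less:
  assumes "\<gamma> \<in> configs" "u \<in> \<gamma> - {x}" "nearer x u v"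
  shows "neighbour_rank x \<gamma> u < neighbour_rank x \<gamma> v"
  unfolding neighbour_rank_def
proof (rule psubset_card_mono[OF finite_nearer[OF assms(1)]])
  show "{w \<in> \<gamma> - {x}. nearer x w u} \<subset> {w \<in> \<gamma> - {x}. nearer x w v}"
    using assms nearer_trans nearer_irrefl by blast
qed

lemma rank_inj: "\<gamma> \<in> configs \<Longrightarrow> inj_on (neighbour_rank x \<gamma>) (\<gamma> - {x})"
  by (rule inj_onI) (metis less_irrefl nearer_total rank_less)

text \<open>Ranks are injective, so a set of points of rank below \<open>m\<close> has at most \<open>m\<close> elements. Hence some point
  has rank at least \<open>i - 1\<close>, and one of least rank among those has no more than \<open>i - 1\<close> predecessors.\<close>

lemma has_neighbour_iff:
  assumes \<gamma>: "\<gamma> \<in> configs"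
  shows "has_neighbour i x \<gamma> \<longleftrightarrow> (\<exists>y \<in> \<gamma> - {x}. Suc (neighbour_rank x \<gamma> y) = i)"
proof
  assume h: "has_neighbour i x \<gamma>"
  have small: "finite M \<and> card M \<le> m"
    if "M \<subseteq> \<gamma> - {x}" "\<And>y. y \<in> M \<Longrightarrow> neighbour_rank x \<gamma> y < m" for M m
  proof -
    have inj: "inj_on (neighbour_rank x \<gamma>) M" using rank_inj[OF \<gamma>] that(1) by (rule inj_on_subset)
    have sub: "neighbour_rank x \<gamma> ` M \<subseteq> {..<m}" using that(2) by auto
    then have "finite M" using inj finite_imageD[of "neighbour_rank x \<gamma>" M] finite_subset by blast
    then show ?thesis using card_inj_on_le[OF inj sub] by simp
  qed
  have "\<exists>y \<in> \<gamma> - {x}. i - 1 \<le> neighbour_rank x \<gamma> y"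
  proof (rule ccontr)
    assume "\<not> ?thesis"
    then have "finite (\<gamma> - {x}) \<and> card (\<gamma> - {x}) \<le> i - 1"
      by (intro small) (auto simp: not_le)
    then show False using h by (auto simp: has_neighbour_def)
  qed
  then obtain y where y: "y \<in> \<gamma> - {x}" "i - 1 \<le> neighbour_rank x \<gamma> y"
    and least: "\<And>u. u \<in> \<gamma> - {x} \<Longrightarrow> i - 1 \<le> neighbour_rank x \<gamma> u \<Longrightarrow> neighbour_rank x \<gamma> y \<le> neighbour_rank x \<gamma> u"
    using exists_least_iff[of "\<lambda>n. \<exists>y \<in> \<gamma> - {x}. i - 1 \<le> neighbour_rank x \<gamma> y \<and> neighbour_rank x \<gamma> y = n"]
    by (metis (no_types, lifting) linorder_not_less)
  have "neighbour_rank x \<gamma> u < i - 1" if "u \<in> \<gamma> - {x}" "nearer x u y" for u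
    using rank_less[OF \<gamma> that] least[OF that(1)] by linarith
  then have "card {u \<in> \<gamma> - {x}. nearer x u y} \<le> i - 1"
    using small[of "{u \<in> \<gamma> - {x}. nearer x u y}" "i - 1"] by auto
  then have "Suc (neighbour_rank x \<gamma> y) = i" using y h by (auto simp: neighbour_rank_def has_neighbour_def)
  then show "\<exists>y \<in> \<gamma> - {x}. Suc (neighbour_rank x \<gamma> y) = i" using y(1) by blast
next
  assume "\<exists>y \<in> \<gamma> - {x}. Suc (neighbour_rank x \<gamma> y) = i"
  then obtain y where y: "y \<in> \<gamma> - {x}" "Suc (neighbour_rank x \<gamma> y) = i" by blast
  have "i \<le> card (\<gamma> - {x})" if "finite \<gamma>"
  proof -
    have "{u \<in> \<gamma> - {x}. nearer x u y} \<subset> \<gamma> - {x}" using y(1) nearer_irrefl by blast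
    from psubset_card_mono[OF _ this] show ?thesis using y(2) that by (simp add: neighbour_rank_def)
  qed
  then show "has_neighbour i x \<gamma>" using y(2) by (auto simp: has_neighbour_def)
qed

lemma neighbour_eq:
  assumes \<gamma>: "\<gamma> \<in> configs" and y: "y \<in> \<gamma> - {x}" "Suc (neighbour_rank x \<gamma> y) = i"
  shows "neighbour i x \<gamma> = y"
  unfolding neighbour_def neighbour_rank_def[symmetric]
  using y rank_inj[OF \<gamma>, of x] by (intro the_equality) (auto dest: inj_onD)

lemma neighbours_iff:
  assumes \<gamma>: "\<gamma> \<in> configs"
  shows "y \<in> neighbours k x \<gamma> \<longleftrightarrow> y \<in> \<gamma> \<and> y \<noteq> x \<and> neighbour_rank x \<gamma> y < k"
proof
  assume "y \<in> neighbours k x \<gamma>"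
  then obtain i where i: "i \<le> k" "has_neighbour i x \<gamma>" "y = neighbour i x \<gamma>"
    by (auto simp: neighbours_def)
  then show "y \<in> \<gamma> \<and> y \<noteq> x \<and> neighbour_rank x \<gamma> y < k"
    using has_neighbour_iff[OF \<gamma>, of i x] neighbour_eq[OF \<gamma>, of _ x i] by force
next
  assume y: "y \<in> \<gamma> \<and> y \<noteq> x \<and> neighbour_rank x \<gamma> y < k"
  then have "has_neighbour (Suc (neighbour_rank x \<gamma> y)) x \<gamma>" "neighbour (Suc (neighbour_rank x \<gamma> y)) x \<gamma> = y"
    using has_neighbour_iff[OF \<gamma>] neighbour_eq[OF \<gamma>] by auto
  then show "y \<in> neighbours k x \<gamma>" using y unfolding neighbours_def by (metis (mono_tags, lifting) Suc_leI mem_Collect_eq)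
qed

lemma finite_neighbours: "finite (neighbours k x \<gamma>)"
  by (rule finite_surj[of "{..k}" _ "\<lambda>i. neighbour i x \<gamma>"]) (auto simp: neighbours_def)

lemma rank_insert:
  assumes "\<not> nearer x w y" shows "neighbour_rank x (insert w \<gamma>) y = neighbour_rank x \<gamma> y"
proof -
  have "{u \<in> insert w \<gamma> - {x}. nearer x u y} = {u \<in> \<gamma> - {x}. nearer x u y}" using assms by auto
  then show ?thesis by (simp add: neighbour_rank_def)
qed

text \<open>One of the points in \<open>B\<close> may be \<open>x\<close> itself, which is why more than \<open>k\<close> of them are required.\<close>

lemma rank_ge:
  assumes \<gamma>: "\<gamma> \<in> configs" and B: "bounded B" "k < card (\<gamma> \<inter> B)" "\<And>p. p \<in> B \<Longrightarrow> dist x p < dist x y"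
  shows "k \<le> neighbour_rank x \<gamma> y"
proof -
  have "k \<le> card (\<gamma> \<inter> B - {x})"
    using B(2) card_Diff1_le[of "\<gamma> \<inter> B" x] by (cases "x \<in> \<gamma> \<inter> B") (auto simp: card_Diff_singleton)
  also have "\<dots> \<le> neighbour_rank x \<gamma> y"
    unfolding neighbour_rank_def using B(3) by (intro card_mono finite_nearer \<gamma>) (auto simp: nearer_def)
  finally show ?thesis .
qed

lemma displaced_iff:
  assumes \<gamma>: "\<gamma> \<in> configs"
  shows "x \<in> neighbours k y (\<gamma> \<union> {x}) \<longleftrightarrow> x \<noteq> y \<and> neighbour_rank y \<gamma> x < k"
  using neighbours_iff[OF configs_insert[OF \<gamma>], of x k y x] rank_insert[OF nearer_irrefl, of y x \<gamma>]
  by auto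

section \<open>The local energy\<close>

lemma exp_ereal_le_one: "t \<le> 0 \<Longrightarrow> exp_ereal t \<le> 1"
  by (cases t) (auto simp: exp_ereal_def ennreal_le_1)

locale knn_energy =
  fixes k :: nat and z \<beta> :: real
    and \<Phi> :: "real ^ 'n::{finite,linorder} \<Rightarrow> ereal" and \<phi> :: "real \<Rightarrow> ereal"
  assumes z_pos: "z > 0" and \<beta>_nonneg: "\<beta> \<ge> 0"
    and \<Phi>_meas: "\<Phi> \<in> borel_measurable borel"
    and radial: "\<And>x. \<Phi> x = \<phi> (norm x)"
    and decreasing: "monotone_on {0..} (\<le>) (\<ge>) \<phi>"
    and \<phi>_nonneg: "\<And>r. r \<ge> 0 \<Longrightarrow> \<phi> r \<ge> 0"
begin

lemma \<Phi>_nonneg: "\<Phi> x \<ge> 0"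
  by (simp add: radial \<phi>_nonneg)

lemma \<Phi>_antimono: "norm x \<le> norm y \<Longrightarrow> \<Phi> y \<le> \<Phi> x"
  unfolding radial using decreasing by (auto simp: monotone_on_def)

definition last_term :: "real ^ 'n::{finite,linorder} \<Rightarrow> (real ^ 'n::{finite,linorder}) set \<Rightarrow> ereal"
  where "last_term y \<gamma> = (if has_neighbour k y \<gamma> then \<Phi> (y - neighbour k y \<gamma>) else 0)"

text \<open>If \<open>x\<close> enters the first \<open>k\<close> neighbours of \<open>y\<close>, then it is at most as far from \<open>y\<close> as the \<open>k\<close>-th
  neighbour that it displaces. As \<open>\<Phi>\<close> decreases with the distance, the exchange costs energy; this is
  what bounds the intensity by \<open>z\<close>.\<close>

lemma displacement_nonneg:
  assumes \<gamma>: "\<gamma> \<in> configs" and x: "neighbour_rank y \<gamma> x < k"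
  shows "0 \<le> \<Phi> (y - x) - last_term y \<gamma>"
proof (cases "has_neighbour k y \<gamma>")
  case True
  then obtain v where v: "v \<in> \<gamma> - {y}" "Suc (neighbour_rank y \<gamma> v) = k" using has_neighbour_iff[OF \<gamma>] by blast
  have "\<not> nearer y v x" using rank_less[OF \<gamma> v(1), of x] v(2) x by auto
  then have "dist y x \<le> dist y v" by (auto simp: nearer_def)
  then have "\<Phi> (y - v) \<le> \<Phi> (y - x)" by (intro \<Phi>_antimono) (simp add: dist_norm)
  then show ?thesis using True neighbour_eq[OF \<gamma> v] by (simp add: last_term_def ereal_diff_positive)
qed (simp add: last_term_def \<Phi>_nonneg)

lemma local_energy_alt:
  assumes \<gamma>: "\<gamma> \<in> configs"
  shows "local_energy \<Phi> k x \<gamma> = (\<Sum>y \<in> {y \<in> \<gamma>. y \<noteq> x \<and> neighbour_rank x \<gamma> y < k}. \<Phi> (x - y)) +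
    (\<Sum>y \<in> {y \<in> \<gamma>. y \<noteq> x \<and> neighbour_rank y \<gamma> x < k}. \<Phi> (y - x) - last_term y \<gamma>)"
proof -
  have "neighbours k x \<gamma> = {y \<in> \<gamma>. y \<noteq> x \<and> neighbour_rank x \<gamma> y < k}"
    using neighbours_iff[OF \<gamma>] by auto
  moreover have "{y \<in> \<gamma>. x \<in> neighbours k y (\<gamma> \<union> {x})} = {y \<in> \<gamma>. y \<noteq> x \<and> neighbour_rank y \<gamma> x < k}"
    unfolding displaced_iff[OF \<gamma>] by auto
  ultimately show ?thesis by (simp add: local_energy_def last_term_def)
qed

lemma local_energy_nonneg: "\<gamma> \<in> configs \<Longrightarrow> 0 \<le> local_energy \<Phi> k x \<gamma>"
  unfolding local_energy_alt
  by (intro add_nonneg_nonneg sum_nonneg) (auto intro: \<Phi>_nonneg displacement_nonneg)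

abbreviation lam :: "real ^ 'n::{finite,linorder} \<Rightarrow> (real ^ 'n::{finite,linorder}) set \<Rightarrow> ennreal"
  where "lam \<equiv> knn_papangelou z \<beta> \<Phi> k"

lemma lam_le: "\<gamma> \<in> configs \<Longrightarrow> lam x \<gamma> \<le> ennreal z"
proof -
  assume "\<gamma> \<in> configs"
  then have "exp_ereal (- (ereal \<beta> * local_energy \<Phi> k x \<gamma>)) \<le> 1"
    using \<beta>_nonneg local_energy_nonneg[of \<gamma> x] by (intro exp_ereal_le_one) simp
  then show ?thesis unfolding knn_papangelou_def using mult_left_mono[of _ 1 "ennreal z"] by simp
qed

lemma lam_empty: "lam x {} = ennreal z"
proof -
  have "local_energy \<Phi> k x {} = 0" by (subst local_energy_alt) (simp_all add: configs_def)
  then show ?thesis by (simp add: knn_papangelou_def exp_ereal_def zero_ereal_def)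
qed

end

section \<open>Shielding\<close>

text \<open>Around \<open>x\<close> there are balls at distance \<open>R\<close>, one in each direction of a finite net \<open>V\<close> of the unit
  sphere, and each holds more than \<open>k\<close> points. Wherever a point \<open>y\<close> lies beyond distance \<open>R\<close>, the ball in
  roughly its direction provides \<open>k\<close> points that are closer to \<open>y\<close> than \<open>x\<close> is. One point more than
  \<open>k\<close> is needed because \<open>y\<close> may itself lie in the ball.\<close>

definition shielded :: "nat \<Rightarrow> (real ^ 'n::{finite,linorder}) set \<Rightarrow> real \<Rightarrow> real ^ 'n::{finite,linorder} \<Rightarrow> (real ^ 'n::{finite,linorder}) set \<Rightarrow> bool"
  where "shielded k V R x \<gamma> \<longleftrightarrow> (\<forall>v\<in>V. k < card (\<gamma> \<inter> ball (x + R *\<^sub>R v) (R / 4)))"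

lemma direction_net:
  obtains V :: "('a::euclidean_space) set" where "finite V" "V \<noteq> {}" "\<And>v. v \<in> V \<Longrightarrow> norm v = 1"
    "\<And>u. norm u = 1 \<Longrightarrow> \<exists>v\<in>V. dist v u < 1/4"
proof -
  have "compact (sphere (0::'a) 1)" by simp
  then obtain V where V: "V \<subseteq> sphere (0::'a) 1" "finite V" "sphere 0 1 \<subseteq> (\<Union>v\<in>V. ball v (1/4))"
    using compactE_image[of "sphere (0::'a) 1" "sphere 0 1" "\<lambda>v. ball v (1/4)"] by force
  obtain u :: 'a where "norm u = 1" using vector_choose_size[of 1] by auto
  then have "V \<noteq> {}" using V(3) by auto
  with V show ?thesis by (intro that[of V]) (auto simp: subset_iff)
qed

locale shielding =
  fixes V :: "(real ^ 'n::{finite,linorder}) set" and R :: real and k :: nat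
  assumes V_finite: "finite V" and V_nonempty: "V \<noteq> {}" and V_unit: "\<And>v. v \<in> V \<Longrightarrow> norm v = 1"
    and V_net: "\<And>u. norm u = 1 \<Longrightarrow> \<exists>v\<in>V. dist v u < 1/4"
    and R_pos: "R > 0"
begin

lemma ball_dist:
  assumes "v \<in> V" "p \<in> ball (x + R *\<^sub>R v) (R / 4)" shows "dist x p < 5 * R / 4"
proof -
  have "dist x p \<le> dist x (x + R *\<^sub>R v) + dist (x + R *\<^sub>R v) p" by (rule dist_triangle)
  also have "dist x (x + R *\<^sub>R v) = R" using V_unit[OF assms(1)] R_pos by (simp add: dist_norm)
  finally show ?thesis using assms(2) by simp
qed

lemma shielded_insert:
  assumes "4 * R \<le> dist x w"
  shows "shielded k V R x (insert w \<gamma>) \<longleftrightarrow> shielded k V R x \<gamma>"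
proof -
  have "w \<notin> ball (x + R *\<^sub>R v) (R / 4)" if "v \<in> V" for v
    using ball_dist[OF that, of w x] assms R_pos by linarith
  then show ?thesis by (simp add: shielded_def Int_insert_left)
qed

context
  fixes \<gamma> x
  assumes \<gamma>: "\<gamma> \<in> configs" and sh: "shielded k V R x \<gamma>"
begin

text \<open>Let \<open>u\<close> be the direction of \<open>y\<close> seen from \<open>x\<close>. A point \<open>p\<close> of the ball in a direction \<open>v\<close> close to
  \<open>u\<close> has distance less than \<open>R / 2\<close> from \<open>x + R u\<close>, which is closer to \<open>y\<close> than \<open>x\<close> by the full
  amount \<open>R\<close>.\<close>

lemma shielded_far:
  assumes y: "R \<le> dist x y" shows "k \<le> neighbour_rank y \<gamma> x"
proof -
  define r where "r = dist x y"
  define u where "u = (y - x) /\<^sub>R r"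
  have r: "r \<ge> R" "r > 0" using y R_pos by (auto simp: r_def)
  have u: "norm u = 1" "y = x + r *\<^sub>R u" using r by (auto simp: u_def r_def dist_norm norm_minus_commute)
  obtain v where v: "v \<in> V" "dist v u < 1/4" using V_net[OF u(1)] by blast
  show ?thesis
  proof (rule rank_ge[OF \<gamma>, of "ball (x + R *\<^sub>R v) (R / 4)"])
    show "k < card (\<gamma> \<inter> ball (x + R *\<^sub>R v) (R / 4))" using sh v by (simp add: shielded_def)
    fix p assume p: "p \<in> ball (x + R *\<^sub>R v) (R / 4)"
    have "dist y p \<le> dist y (x + R *\<^sub>R u) + (dist (x + R *\<^sub>R u) (x + R *\<^sub>R v) + dist (x + R *\<^sub>R v) p)"
      by (meson add_left_mono dist_triangle order_trans)
    also have "dist y (x + R *\<^sub>R u) = r - R"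
      using r u by (simp add: dist_norm scaleR_diff_left[symmetric])
    also have "dist (x + R *\<^sub>R u) (x + R *\<^sub>R v) = R * dist v u"
      using R_pos by (simp add: dist_norm scaleR_diff_right[symmetric] norm_minus_commute)
    also have "\<dots> < R / 4" using v R_pos by simp
    finally have "dist y p < r" using p R_pos by simp
    then show "dist y p < dist y x" by (simp add: r_def dist_commute)
  qed simp
qed

text \<open>Any one of the balls lies within distance \<open>5 * R / 4\<close> of \<open>x\<close> and so provides \<open>k\<close> neighbours for \<open>y\<close>
  that are closer than \<open>w\<close>.\<close>

lemma shielded_rank:
  assumes y: "dist x y + 5 * R / 4 \<le> dist y w" shows "k \<le> neighbour_rank y \<gamma> w"
proof -
  obtain v where v: "v \<in> V" using V_nonempty by blast
  show ?thesis
  proof (rule rank_ge[OF \<gamma>, of "ball (x + R *\<^sub>R v) (R / 4)"])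
    show "k < card (\<gamma> \<inter> ball (x + R *\<^sub>R v) (R / 4))" using sh v by (simp add: shielded_def)
    fix p assume "p \<in> ball (x + R *\<^sub>R v) (R / 4)"
    then show "dist y p < dist y w"
      using ball_dist[OF v, of p x] y dist_triangle[of y p x] by (simp add: dist_commute)
  qed simp
qed

end

end

locale shielded_energy = knn_energy k z \<beta> \<Phi> \<phi> + shielding V R k
  for k z \<beta> and \<Phi> :: "real ^ 'n::{finite,linorder} \<Rightarrow> ereal" and \<phi> and V :: "(real ^ 'n::{finite,linorder}) set" and R
begin

text \<open>Under shielding, only points \<open>y\<close> closer to \<open>x\<close> than \<open>R\<close> can have \<open>x\<close> among their first \<open>k\<close>
  neighbours, and the first \<open>k\<close> neighbours of \<open>x\<close> and of such \<open>y\<close> lie within \<open>5 * R / 4\<close> and \<open>9 * R / 4\<close>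
  of these points. A point at distance at least \<open>4 * R\<close> from \<open>x\<close> is at distance more than \<open>3 * R\<close> from
  \<open>y\<close>, too far away to be one of them.\<close>

lemma local_energy_insert:
  assumes \<gamma>: "\<gamma> \<in> configs" and sh: "shielded k V R x \<gamma>" and w: "4 * R \<le> dist x w"
  shows "local_energy \<Phi> k x (insert w \<gamma>) = local_energy \<Phi> k x \<gamma>"
proof -
  let ?\<delta> = "insert w \<gamma>"
  have \<delta>: "?\<delta> \<in> configs" by (rule configs_insert[OF \<gamma>])
  have sh': "shielded k V R x ?\<delta>" using sh shielded_insert[OF w] by simp
  have 1: "{y \<in> ?\<delta>. y \<noteq> x \<and> neighbour_rank x ?\<delta> y < k} = {y \<in> \<gamma>. y \<noteq> x \<and> neighbour_rank x \<gamma> y < k}"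
  proof -
    have a: "dist x y < 5 * R / 4" if "neighbour_rank x \<gamma> y < k \<or> neighbour_rank x ?\<delta> y < k" for y
      using that shielded_rank[OF \<gamma> sh, of x y] shielded_rank[OF \<delta> sh', of x y] by force
    have b: "neighbour_rank x ?\<delta> y = neighbour_rank x \<gamma> y \<and> y \<noteq> w" if "dist x y < 5 * R / 4" for y
      using that w R_pos by (auto intro!: rank_insert simp: nearer_def)
    have "y \<in> ?\<delta> \<and> y \<noteq> x \<and> neighbour_rank x ?\<delta> y < k \<longleftrightarrow> y \<in> \<gamma> \<and> y \<noteq> x \<and> neighbour_rank x \<gamma> y < k" for y
      by (cases "dist x y < 5 * R / 4") (use a[of y] b[of y] in auto)
    then show ?thesis by simp
  qed
  have near: "dist x y < R" if "neighbour_rank y \<gamma> x < k \<or> neighbour_rank y ?\<delta> x < k" for y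
    using that shielded_far[OF \<gamma> sh, of y] shielded_far[OF \<delta> sh', of y] by force
  have 2: "{y \<in> ?\<delta>. y \<noteq> x \<and> neighbour_rank y ?\<delta> x < k} = {y \<in> \<gamma>. y \<noteq> x \<and> neighbour_rank y \<gamma> x < k}"
  proof -
    have b: "neighbour_rank y ?\<delta> x = neighbour_rank y \<gamma> x \<and> y \<noteq> w" if "dist x y < R" for y
    proof -
      have "dist y x < dist y w" using that w R_pos dist_triangle[of x w y] by (simp add: dist_commute)
      then show ?thesis using that w R_pos by (auto intro!: rank_insert simp: nearer_def)
    qed
    have "y \<in> ?\<delta> \<and> y \<noteq> x \<and> neighbour_rank y ?\<delta> x < k \<longleftrightarrow> y \<in> \<gamma> \<and> y \<noteq> x \<and> neighbour_rank y \<gamma> x < k" for y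
      by (cases "dist x y < R") (use near[of y] b[of y] in auto)
    then show ?thesis by simp
  qed
  have 3: "last_term y ?\<delta> = last_term y \<gamma>" if y: "dist x y < R" for y
  proof -
    have "v \<in> ?\<delta> - {y} \<and> Suc (neighbour_rank y ?\<delta> v) = k \<longleftrightarrow> v \<in> \<gamma> - {y} \<and> Suc (neighbour_rank y \<gamma> v) = k" for v
    proof (cases "dist x y + 5 * R / 4 \<le> dist y v")
      case True
      then show ?thesis using shielded_rank[OF \<gamma> sh True] shielded_rank[OF \<delta> sh' True] by auto
    next
      case False
      then have "dist y v < dist y w" using y w R_pos dist_triangle[of x w y] by simp
      then have "neighbour_rank y ?\<delta> v = neighbour_rank y \<gamma> v" "v \<noteq> w" by (auto intro!: rank_insert simp: nearer_def)
      then show ?thesis by auto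
    qed
    then have "has_neighbour k y ?\<delta> = has_neighbour k y \<gamma>" "neighbour k y ?\<delta> = neighbour k y \<gamma>"
      unfolding has_neighbour_iff[OF \<gamma>] has_neighbour_iff[OF \<delta>] neighbour_def neighbour_rank_def[symmetric]
      by (auto simp: Bex_def)
    then show ?thesis by (simp add: last_term_def)
  qed
  show ?thesis
    unfolding local_energy_alt[OF \<gamma>] local_energy_alt[OF \<delta>] 1 2
    using 3 near by (intro arg_cong2[where f="(+)"] refl sum.cong) auto
qed

lemma lam_insert:
  "\<gamma> \<in> configs \<Longrightarrow> shielded k V R x \<gamma> \<Longrightarrow> 4 * R \<le> dist x w \<Longrightarrow> lam x (insert w \<gamma>) = lam x \<gamma>"
  by (simp add: knn_papangelou_def local_energy_insert)

end

section \<open>Measurability of the local energy\<close>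

lemma measurable_vec_component [measurable (raw)]:
  assumes "u \<in> borel_measurable M"
  shows "(\<lambda>\<omega>. (u \<omega> :: real ^ 'n::finite) $ i) \<in> borel_measurable M"
  using assms by (rule borel_measurable_continuous_on[rotated]) (intro continuous_intros)

lemma measurable_nearer [measurable (raw)]:
  fixes a u v :: "'b \<Rightarrow> real ^ 'n::{finite,linorder}"
  assumes [measurable]: "a \<in> borel_measurable M" "u \<in> borel_measurable M" "v \<in> borel_measurable M"
  shows "Measurable.pred M (\<lambda>\<omega>. nearer (a \<omega>) (u \<omega>) (v \<omega>))"
  unfolding nearer_def lex_less_def by measurable

lemma measurable_neighbour_rank [measurable (raw)]:
  fixes x y :: "'b \<Rightarrow> real ^ 'n::{finite,linorder}"
  assumes [measurable]: "x \<in> borel_measurable M" "g \<in> measurable M config_space" "y \<in> borel_measurable M"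
  shows "(\<lambda>\<omega>. neighbour_rank (x \<omega>) (g \<omega>) (y \<omega>)) \<in> measurable M (count_space UNIV)"
proof -
  have "(\<lambda>\<omega>. card {u \<in> g \<omega>. u \<noteq> x \<omega> \<and> nearer (x \<omega>) u (y \<omega>)}) \<in> measurable M (count_space UNIV)"
  proof (rule measurable_card_filter)
    fix \<omega> assume "\<omega> \<in> space M"
    then have "g \<omega> \<in> configs" using measurable_space[OF assms(2)] by (simp add: space_config_space)
    from finite_nearer[OF this, of "x \<omega>" "y \<omega>"]
    show "finite {u \<in> g \<omega>. u \<noteq> x \<omega> \<and> nearer (x \<omega>) u (y \<omega>)}"
      by (rule rev_finite_subset) auto
  qed measurable
  also have "(\<lambda>\<omega>. card {u \<in> g \<omega>. u \<noteq> x \<omega> \<and> nearer (x \<omega>) u (y \<omega>)}) = (\<lambda>\<omega>. neighbour_rank (x \<omega>) (g \<omega>) (y \<omega>))"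
    by (auto simp: neighbour_rank_def intro!: ext arg_cong[where f=card])
  finally show ?thesis .
qed

lemma measurable_shielded:
  fixes V :: "(real ^ 'n::{finite,linorder}) set"
  assumes V: "finite V"
  shows "Measurable.pred (borel \<Otimes>\<^sub>M config_space) (\<lambda>(x, \<gamma>). shielded k V R x \<gamma>)"
proof -
  have [measurable]: "(\<lambda>p. card {y \<in> snd p. dist (fst p + R *\<^sub>R v) y < R / 4})
    \<in> measurable (borel \<Otimes>\<^sub>M config_space) (count_space UNIV)" for v :: "real ^ 'n::{finite,linorder}"
  proof (rule measurable_card_filter)
    fix p :: "(real ^ 'n::{finite,linorder}) \<times> (real ^ 'n::{finite,linorder}) set"
    assume "p \<in> space (borel \<Otimes>\<^sub>M config_space)"
    then have "snd p \<in> configs" by (auto simp: space_pair_measure space_config_space)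
    from finite_config_Int[OF this bounded_ball[of "fst p + R *\<^sub>R v" "R / 4"]]
    show "finite {y \<in> snd p. dist (fst p + R *\<^sub>R v) y < R / 4}" by (rule rev_finite_subset) auto
  qed measurable
  have "(\<lambda>(x, \<gamma>). shielded k V R x \<gamma>) = (\<lambda>p. \<forall>v\<in>V. k < card {y \<in> snd p. dist (fst p + R *\<^sub>R v) y < R / 4})"
    by (auto simp: shielded_def Int_def fun_eq_iff)
  also have "Measurable.pred (borel \<Otimes>\<^sub>M config_space) \<dots>"
    using V by measurable
  finally show ?thesis .
qed

context shielded_energy
begin

lemma e2ennreal_measurable: "(\<lambda>x. e2ennreal (\<Phi> x)) \<in> borel_measurable borel"
  by (rule measurable_compose[OF \<Phi>_meas measurable_e2ennreal])

text \<open>At most one point has rank \<open>k - 1\<close>, so this sum selects the \<open>k\<close>-th neighbour. Unlike a definite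
  description it is visibly measurable, and likewise for the sums below.\<close>

definition last_energy :: "real ^ 'n::{finite,linorder} \<Rightarrow> (real ^ 'n::{finite,linorder}) set \<Rightarrow> ennreal"
  where "last_energy y \<gamma> = (\<integral>\<^sup>+u. (if u \<noteq> y \<and> Suc (neighbour_rank y \<gamma> u) = k then e2ennreal (\<Phi> (y - u)) else 0) \<partial>count_space \<gamma>)"

definition own_energy :: "real ^ 'n::{finite,linorder} \<Rightarrow> (real ^ 'n::{finite,linorder}) set \<Rightarrow> ennreal"
  where "own_energy x \<gamma> = (\<integral>\<^sup>+y. (if y \<noteq> x \<and> neighbour_rank x \<gamma> y < k then e2ennreal (\<Phi> (x - y)) else 0) \<partial>count_space \<gamma>)"

definition displaced_energy :: "real ^ 'n::{finite,linorder} \<Rightarrow> (real ^ 'n::{finite,linorder}) set \<Rightarrow> ennreal"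
  where "displaced_energy x \<gamma> = (\<integral>\<^sup>+y. (if y \<noteq> x \<and> neighbour_rank y \<gamma> x < k
     then e2ennreal (\<Phi> (y - x) - enn2ereal (last_energy y \<gamma>)) else 0) \<partial>count_space \<gamma>)"

lemma measurable_last_energy [measurable (raw)]:
  assumes [measurable]: "y \<in> borel_measurable M" "g \<in> measurable M config_space"
  shows "(\<lambda>\<omega>. last_energy (y \<omega>) (g \<omega>)) \<in> borel_measurable M"
proof -
  note [measurable] = e2ennreal_measurable
  show ?thesis unfolding last_energy_def by (rule measurable_sum_points[OF assms(2)]) measurable
qed

lemma measurable_own_energy [measurable (raw)]:
  assumes [measurable]: "x \<in> borel_measurable M" "g \<in> measurable M config_space"
  shows "(\<lambda>\<omega>. own_energy (x \<omega>) (g \<omega>)) \<in> borel_measurable M"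
proof -
  note [measurable] = e2ennreal_measurable
  show ?thesis unfolding own_energy_def by (rule measurable_sum_points[OF assms(2)]) measurable
qed

lemma measurable_displaced_energy [measurable (raw)]:
  assumes [measurable]: "x \<in> borel_measurable M" "g \<in> measurable M config_space"
  shows "(\<lambda>\<omega>. displaced_energy (x \<omega>) (g \<omega>)) \<in> borel_measurable M"
proof -
  note [measurable] = \<Phi>_meas
  show ?thesis unfolding displaced_energy_def by (rule measurable_sum_points[OF assms(2)]) measurable
qed

lemma last_energy:
  assumes \<gamma>: "\<gamma> \<in> configs" shows "enn2ereal (last_energy y \<gamma>) = last_term y \<gamma>"
proof (cases "has_neighbour k y \<gamma>")
  case True
  then obtain v where v: "v \<in> \<gamma> - {y}" "Suc (neighbour_rank y \<gamma> v) = k"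
    using has_neighbour_iff[OF \<gamma>] by blast
  have "{u \<in> \<gamma>. u \<noteq> y \<and> Suc (neighbour_rank y \<gamma> u) = k} = {v}"
    using v rank_inj[OF \<gamma>, of y] by (auto dest: inj_onD)
  then have "last_energy y \<gamma> = e2ennreal (\<Phi> (y - v))"
    unfolding last_energy_def by (subst sum_points_filter) auto
  then show ?thesis using True neighbour_eq[OF \<gamma> v] by (simp add: last_term_def enn2ereal_e2ennreal \<Phi>_nonneg)
next
  case False
  then have empty: "{u \<in> \<gamma>. u \<noteq> y \<and> Suc (neighbour_rank y \<gamma> u) = k} = {}"
    using has_neighbour_iff[OF \<gamma>, of k y] by auto
  then have "finite {u \<in> \<gamma>. u \<noteq> y \<and> Suc (neighbour_rank y \<gamma> u) = k}" by (simp only: finite.emptyI)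
  from sum_points_filter[OF this] have "last_energy y \<gamma> = 0"
    unfolding last_energy_def empty by simp
  then show ?thesis using False by (simp add: last_term_def zero_ennreal.rep_eq)
qed

text \<open>Shielding makes the second sum of the local energy finite, so that it agrees with the integral
  against counting measure.\<close>

lemma local_energy_ennreal:
  assumes \<gamma>: "\<gamma> \<in> configs" and sh: "shielded k V R x \<gamma>"
  shows "local_energy \<Phi> k x \<gamma> = enn2ereal (own_energy x \<gamma> + displaced_energy x \<gamma>)"
proof -
  have "{y \<in> \<gamma>. y \<noteq> x \<and> neighbour_rank x \<gamma> y < k} = neighbours k x \<gamma>"
    using neighbours_iff[OF \<gamma>] by auto
  then have fin1: "finite {y \<in> \<gamma>. y \<noteq> x \<and> neighbour_rank x \<gamma> y < k}"
    by (simp only: finite_neighbours)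
  have "{y \<in> \<gamma>. y \<noteq> x \<and> neighbour_rank y \<gamma> x < k} \<subseteq> \<gamma> \<inter> ball x R"
  proof
    fix y assume y: "y \<in> {y \<in> \<gamma>. y \<noteq> x \<and> neighbour_rank y \<gamma> x < k}"
    then have "dist x y < R" using shielded_far[OF \<gamma> sh, of y] by (auto simp: not_le[symmetric])
    with y show "y \<in> \<gamma> \<inter> ball x R" by simp
  qed
  then have fin2: "finite {y \<in> \<gamma>. y \<noteq> x \<and> neighbour_rank y \<gamma> x < k}"
    by (rule finite_subset) (rule finite_config_Int[OF \<gamma> bounded_ball])
  have "enn2ereal (own_energy x \<gamma>) = (\<Sum>y \<in> {y \<in> \<gamma>. y \<noteq> x \<and> neighbour_rank x \<gamma> y < k}. \<Phi> (x - y))"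
    unfolding own_energy_def sum_points_filter[OF fin1]
    by (subst sum_enn2ereal[symmetric]) (auto intro!: sum.cong simp: enn2ereal_e2ennreal \<Phi>_nonneg)
  moreover have "enn2ereal (displaced_energy x \<gamma>) =
    (\<Sum>y \<in> {y \<in> \<gamma>. y \<noteq> x \<and> neighbour_rank y \<gamma> x < k}. \<Phi> (y - x) - last_term y \<gamma>)"
    unfolding displaced_energy_def sum_points_filter[OF fin2] last_energy[OF \<gamma>]
    by (subst sum_enn2ereal[symmetric]) (auto intro!: sum.cong simp: enn2ereal_e2ennreal displacement_nonneg[OF \<gamma>])
  ultimately show ?thesis by (simp add: local_energy_alt[OF \<gamma>] plus_ennreal.rep_eq)
qed

lemma measurable_exp_ereal: "exp_ereal \<in> borel_measurable borel"
proof -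
  have "exp_ereal = (\<lambda>t. if t = \<infinity> then \<infinity> else if t = - \<infinity> then 0 else ennreal (exp (real_of_ereal t)))"
    by (auto simp: exp_ereal_def fun_eq_iff split: ereal.split)
  also have "\<dots> \<in> borel_measurable borel" by measurable
  finally show ?thesis .
qed

lemma measurable_lam_shielded:
  "(\<lambda>(x, \<gamma>). indicator {(x, \<gamma>). \<gamma> \<in> configs \<and> shielded k V R x \<gamma>} (x, \<gamma>) * lam x \<gamma>)
    \<in> borel_measurable (borel \<Otimes>\<^sub>M config_space)"
proof -
  note [measurable] = measurable_exp_ereal measurable_shielded[OF V_finite]
  have "(\<lambda>p. if shielded k V R (fst p) (snd p) then ennreal z *
      exp_ereal (- (ereal \<beta> * enn2ereal (own_energy (fst p) (snd p) + displaced_energy (fst p) (snd p)))) else 0)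
    \<in> borel_measurable (borel \<Otimes>\<^sub>M config_space)"
    using measurable_shielded[OF V_finite, of k R, unfolded case_prod_unfold] by measurable
  also have "?this \<longleftrightarrow> ?thesis"
  proof (rule measurable_cong)
    fix p :: "(real ^ 'n::{finite,linorder}) \<times> (real ^ 'n::{finite,linorder}) set"
    assume "p \<in> space (borel \<Otimes>\<^sub>M config_space)"
    then have "snd p \<in> configs" by (auto simp: space_pair_measure space_config_space)
    then show "(if shielded k V R (fst p) (snd p) then ennreal z *
      exp_ereal (- (ereal \<beta> * enn2ereal (own_energy (fst p) (snd p) + displaced_energy (fst p) (snd p)))) else 0) =
      (case p of (x, \<gamma>) \<Rightarrow> indicator {(x, \<gamma>). \<gamma> \<in> configs \<and> shielded k V R x \<gamma>} (x, \<gamma>) * lam x \<gamma>)"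
      by (auto simp: knn_papangelou_def local_energy_ennreal split: prod.split)
  qed
  finally show ?thesis .
qed

end

section \<open>Gibbs processes with nearest-neighbour interaction\<close>

text \<open>The windows exhaust the space, so they have positive volume from some index on.\<close>

lemma variance_linear_imp_not_hyperuniform:
  assumes \<Lambda>: "exhausting \<Lambda>" and c: "c > 0"
    and lower: "\<And>n. c * measure lborel (\<Lambda> n) \<le> prob_space.variance P (\<lambda>\<gamma>. real (card (\<gamma> \<inter> \<Lambda> n)))"
  shows "\<not> (\<lambda>n. prob_space.variance P (\<lambda>\<gamma>. real (card (\<gamma> \<inter> \<Lambda> n))) / measure lborel (\<Lambda> n)) \<longlonglongrightarrow> 0"
proof
  assume lim: "(\<lambda>n. prob_space.variance P (\<lambda>\<gamma>. real (card (\<gamma> \<inter> \<Lambda> n))) / measure lborel (\<Lambda> n)) \<longlonglongrightarrow> 0"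
  have sets: "\<Lambda> n \<in> sets borel" and fin: "emeasure lborel (\<Lambda> n) < \<infinity>" for n
    using \<Lambda> emeasure_bounded_finite by (auto simp: exhausting_def)
  have "\<exists>n. emeasure lborel (\<Lambda> n) \<noteq> 0"
  proof (rule ccontr)
    assume "\<not> ?thesis"
    then have "emeasure lborel (\<Union>n. \<Lambda> n) = 0" using sets by (intro emeasure_UN_eq_0) auto
    then show False using \<Lambda> by (simp add: exhausting_def)
  qed
  then obtain m where m: "emeasure lborel (\<Lambda> m) \<noteq> 0" by blast
  have pos: "measure lborel (\<Lambda> n) > 0" if "n \<ge> m" for n
  proof -
    have "emeasure lborel (\<Lambda> m) \<le> emeasure lborel (\<Lambda> n)"
      using \<Lambda> that sets by (intro emeasure_mono) (auto simp: exhausting_def incseq_def)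
    then have "emeasure lborel (\<Lambda> n) \<noteq> 0" using m by auto
    then show ?thesis using fin[of n] by (simp add: measure_def enn2real_positive_iff zero_less_iff_neq_zero)
  qed
  have "c \<le> 0"
  proof (rule tendsto_lowerbound[OF lim])
    show "\<forall>\<^sub>F n in sequentially. c \<le> prob_space.variance P (\<lambda>\<gamma>. real (card (\<gamma> \<inter> \<Lambda> n))) / measure lborel (\<Lambda> n)"
      using eventually_ge_at_top[of m] by eventually_elim (use lower pos in \<open>simp add: pos_le_divide_eq\<close>)
  qed simp
  with c show False by simp
qed

lemma (in shielded_energy) shielded_local_event:
  assumes "gibbs_process P lam z" "\<Lambda> \<in> sets borel" "bounded \<Lambda>"
  shows "gibbs_local_event P lam z {(x, \<gamma>). \<gamma> \<in> configs \<and> shielded k V R x \<gamma>} (4 * R) \<Lambda>"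
proof -
  interpret gibbs_process P lam z by fact
  have "{p \<in> space (borel \<Otimes>\<^sub>M config_space). (\<lambda>(x, \<gamma>). shielded k V R x \<gamma>) p} \<in> sets (borel \<Otimes>\<^sub>M config_space)"
    using measurable_shielded[OF V_finite] by measurable
  also have "{p \<in> space (borel \<Otimes>\<^sub>M config_space). (\<lambda>(x, \<gamma>). shielded k V R x \<gamma>) p} =
    {(x, \<gamma>). \<gamma> \<in> configs \<and> shielded k V R x \<gamma>}"
    by (auto simp: space_pair_measure space_config_space)
  finally show ?thesis
    using assms R_pos measurable_lam_shielded lam_insert
    by unfold_locales (auto simp: shielded_insert configs_insert)
qed

theorem corollary7:
  fixes k :: nat and z \<beta> :: real
    and \<Phi> :: "real ^ 'n::{finite,linorder} \<Rightarrow> ereal" and \<phi> :: "real \<Rightarrow> ereal"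
    and P :: "(real ^ 'n::{finite,linorder}) set measure"
  assumes "z > 0" and "\<beta> \<ge> 0"
    and "\<Phi> \<in> borel_measurable borel"
    and "\<And>x. \<Phi> x = \<phi> (norm x)"
    and "monotone_on {0..} (\<le>) (\<ge>) \<phi>"
    and "\<And>r. r \<ge> 0 \<Longrightarrow> \<phi> r \<ge> 0"
    and "stationary P"
    and "gibbs (knn_papangelou z \<beta> \<Phi> k) P"
  shows "\<forall>\<Lambda>. exhausting \<Lambda> \<longrightarrow> \<not> hyperuniform_along \<Lambda> P"
proof (intro allI impI notI)
  fix \<Lambda> :: "nat \<Rightarrow> (real ^ 'n::{finite,linorder}) set"
  assume \<Lambda>: "exhausting \<Lambda>" and hyper: "hyperuniform_along \<Lambda> P"
  interpret knn_energy k z \<beta> \<Phi> \<phi> using assms by unfold_locales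
  interpret gibbs_process P lam z using assms lam_le by unfold_locales
  have inf: "AE \<gamma> in P. infinite \<gamma>"
    using stationary_infinite[OF \<open>stationary P\<close> lam_empty] .
  obtain \<rho> :: real where \<rho>: "\<rho> > 0" and density: "\<And>\<Lambda>. \<Lambda> \<in> sets borel \<Longrightarrow>
    (\<integral>\<^sup>+\<gamma>. (\<integral>\<^sup>+x. indicator \<Lambda> x \<partial>count_space \<gamma>) \<partial>P) = ennreal \<rho> * emeasure lborel \<Lambda>"
    using stationary_density[OF \<open>stationary P\<close> inf] by blast
  obtain V :: "(real ^ 'n::{finite,linorder}) set" where V: "finite V" "V \<noteq> {}" "\<And>v. v \<in> V \<Longrightarrow> norm v = 1"
    "\<And>u. norm u = 1 \<Longrightarrow> \<exists>v\<in>V. dist v u < 1/4"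
    using direction_net by blast
  define E where "E n = {\<gamma> \<in> configs. card (\<gamma> \<inter> ball (0 :: real ^ 'n::{finite,linorder}) (real n)) \<le> k}" for n
  define \<epsilon> where "\<epsilon> n = real (card V) * prob (E n)" for n
  have "(\<lambda>n. z * \<epsilon> n) \<longlonglongrightarrow> z * (real (card V) * 0)"
    unfolding \<epsilon>_def E_def by (intro tendsto_intros few_points_tendsto_0 inf)
  then have "eventually (\<lambda>n. z * \<epsilon> n < \<rho> / 2) sequentially"
    using \<rho> by (intro order_tendstoD(2)[where y = 0]) auto
  then have "eventually (\<lambda>n. z * \<epsilon> n < \<rho> / 2 \<and> n \<ge> 1) sequentially"
    using eventually_ge_at_top[of 1] by (rule eventually_conj)
  \<comment> \<open>The unmarked points are then at most half of all points.\<close>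
  then obtain n where n: "z * \<epsilon> n < \<rho> / 2" "n \<ge> 1" by (auto simp: eventually_sequentially)
  \<comment> \<open>The balls in the definition of shielding then have radius \<open>n\<close>.\<close>
  define R where "R = 4 * real n"
  interpret shielded_energy k z \<beta> \<Phi> \<phi> V R using V n by unfold_locales (auto simp: R_def)
  define A where "A = {(x, \<gamma>). \<gamma> \<in> configs \<and> shielded k V R x \<gamma>}"
  have rare: "emeasure P {\<gamma> \<in> configs. (x, \<gamma>) \<notin> A} \<le> ennreal (\<epsilon> n)" for x
  proof -
    define F where "F v = {\<gamma> \<in> configs. card (\<gamma> \<inter> ball (x + R *\<^sub>R v) (real n)) \<le> k}" for v
    have F_sets: "F v \<in> events" for v
    proof -
      have [measurable]: "(\<lambda>\<gamma>. card (\<gamma> \<inter> ball (x + R *\<^sub>R v) (real n))) \<in> measurable config_space (count_space UNIV)"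
        by (rule measurable_card_Int) auto
      have "{\<gamma> \<in> space config_space. card (\<gamma> \<inter> ball (x + R *\<^sub>R v) (real n)) \<le> k} \<in> sets config_space" by measurable
      then show ?thesis by (simp add: F_def space_config_space sets_P)
    qed
    have "{\<gamma> \<in> configs. (x, \<gamma>) \<notin> A} = (\<Union>v\<in>V. F v)"
      by (auto simp: A_def F_def shielded_def R_def not_less)
    also have "emeasure P \<dots> \<le> (\<Sum>v\<in>V. emeasure P (F v))"
      using V(1) F_sets by (intro emeasure_subadditive_finite) auto
    also have "\<dots> = (\<Sum>v\<in>V. emeasure P (E n))"
      unfolding F_def E_def by (intro sum.cong refl stationary_few_points \<open>stationary P\<close>)
    also have "\<dots> = ennreal (\<epsilon> n)"
      by (simp add: \<epsilon>_def emeasure_eq_measure ennreal_mult ennreal_of_nat_eq_real_of_nat)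
    finally show ?thesis .
  qed
  define C where "C = z + 2 * z\<^sup>2 * (unit_ball_vol (real DIM(real ^ 'n::{finite,linorder})) * (4 * R) ^ DIM(real ^ 'n::{finite,linorder}))"
  have C: "C > 0"
    using \<open>z > 0\<close> R_pos by (auto simp: C_def intro!: add_pos_nonneg mult_nonneg_nonneg)
  have "(\<rho> / 2)\<^sup>2 / C * measure lborel (\<Lambda> i) \<le> variance (\<lambda>\<gamma>. real (card (\<gamma> \<inter> \<Lambda> i)))" for i
  proof -
    have \<Lambda>_i: "\<Lambda> i \<in> sets borel" "bounded (\<Lambda> i)" using \<Lambda> by (auto simp: exhausting_def)
    interpret loc: gibbs_local_event P lam z A "4 * R" "\<Lambda> i"
      unfolding A_def using shielded_local_event[OF gibbs_process_axioms \<Lambda>_i] .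
    have "ennreal ((\<rho> - z * \<epsilon> n) * measure lborel (\<Lambda> i)) \<le> (\<integral>\<^sup>+\<gamma>. loc.compensator \<gamma> \<partial>P)"
      using n \<rho> by (intro loc.mean_compensator_lower_bound rare density \<Lambda>_i) (auto simp: \<epsilon>_def)
    moreover have "\<rho> / 2 * measure lborel (\<Lambda> i) \<le> (\<rho> - z * \<epsilon> n) * measure lborel (\<Lambda> i)"
      using n by (intro mult_right_mono) auto
    ultimately have "ennreal (\<rho> / 2 * measure lborel (\<Lambda> i)) \<le> (\<integral>\<^sup>+\<gamma>. loc.compensator \<gamma> \<partial>P)"
      using ennreal_leI order_trans by blast
    from loc.variance_lower_bound[OF _ _ this]
    have "(\<rho> / 2)\<^sup>2 * measure lborel (\<Lambda> i) \<le> C * variance (\<lambda>\<gamma>. real (card (\<gamma> \<inter> \<Lambda> i)))"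
      using hyper \<rho> by (simp add: hyperuniform_along_def C_def loc.near_volume_def)
    then show ?thesis using C by (simp add: divide_le_eq mult.commute)
  qed
  then have "\<not> (\<lambda>i. variance (\<lambda>\<gamma>. real (card (\<gamma> \<inter> \<Lambda> i))) / measure lborel (\<Lambda> i)) \<longlonglongrightarrow> 0"
    using \<rho> C by (intro variance_linear_imp_not_hyperuniform[OF \<Lambda>, of "(\<rho> / 2)\<^sup>2 / C"]) auto
  then show False using hyper by (simp add: hyperuniform_along_def)
qed

end
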